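(* Let $r\in\{0,1\}$ and let $M=H$ be $\mathbb S^3$ ($r=0$) or $\mathrm{AdS}_3$ ($r=1$). Let $Y\in\mathfrak m$ be a non-null unit vector, i.e. $\|Y\|^2:=\langle Y,Y\rangle\in\{+1,-1\}$ (necessarily $\|Y\|^2=1$ when $r=0$). For $\epsilon\in\mathcal E_r$ set $\epsilon_Y=(-1)^r\|Y\|^2\epsilon\in\mathcal E_r$. Then $$\psi^R_{Y,\epsilon}=\xi^R_Y\cdot\psi^{\mathcal K^+}_{\epsilon_Y},\qquad \psi^L_{Y,\epsilon}=\xi^L_Y\cdot\psi^{\mathcal K^-}_{\epsilon_Y}$$ are $\epsilon$-unit generalized Killing spinors. In the gauge determined by the global section $q\mapsto(q,\mathbf 1)$ they are $$\psi^R_{Y,\epsilon}(q)=[(q,\mathbf 1),q^{-1}\gamma(Y)q\,\mathbb 1_{\epsilon_Y}],\qquad \psi^L_{Y,\epsilon}(q)=[(q,\mathbf 1),\gamma(Y)q^{-1}\,\mathbb 1_{\epsilon_Y}].$$ Their associated tensors are $$A^R_Y(\mathcal X)=-\tfrac32\mathcal X+2\|Y\|^2g(\xi^R_Y,\mathcal X)\xi^R_Y,\qquad A^L_Y(\mathcal X)=\tfrac32\mathcal X-2\|Y\|^2g(\xi^L_Y,\mathcal X)\xi^L_Y.$$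
   Context: Algebra. $\mathfrak m=(\mathbb R^{r,3-r},\langle\cdot,\cdot\rangle)$ is oriented with oriented orthonormal basis $X_0,X_1,X_2$, $\langle X_0,X_0\rangle=(-1)^r$, $\langle X_1,X_1\rangle=\langle X_2,X_2\rangle=1$; the cross product is defined by $\langle X\times Y,Z\rangle=\mathrm{vol}(X,Y,Z)$, $\mathrm{vol}(X_0,X_1,X_2)=1$. $H=\mathrm{SU}(2)$ if $r=0$, $H=\mathrm{SU}(1,1)$ if $r=1$, with Lie algebra $\mathfrak h$. Put $\gamma_1=\begin{pmatrix}0&1\\-1&0\end{pmatrix}$, $\gamma_2=\begin{pmatrix}0&\sqrt{-1}\\ \sqrt{-1}&0\end{pmatrix}$, and $\gamma_0=\mathrm{diag}(\sqrt{-1},-\sqrt{-1})$ if $r=0$, $\gamma_0=\mathrm{diag}(1,-1)$ if $r=1$; $\gamma\colon\mathfrak m\to\mathfrak{gl}(2,\mathbb C)$ is linear with $\gamma(X_k)=\gamma_k$. $\lambda\colon H\to\mathrm{SO}_0(\mathfrak m)$ is the double covering with $\gamma(\lambda(h)X)=h\gamma(X)h^{-1}$. $l_g\colon\mathfrak m\to\mathfrak h$ is the linear isomorphism with $\lambda_*(l_g(X))Y=X\times Y$ (explicitly $l_g(X)=\frac{(\sqrt{-1})^r}{2}\gamma(X)$). Space. $M=H$ carries the bi-invariant metric $g$ of constant sectional curvature $(-1)^r$, i.e. $g_q(2q\,l_g(X),2q\,l_g(Y))=\langle X,Y\rangle$. Its principal spin bundle is $P=H\times H$ with $\pi(g_L,g_R)=g_Lg_R^\dagger$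 and right $H$-action $(g_L,g_R)\cdot h=(g_Lh,g_R(h^{-1})^\dagger)$; the solder form and spin Levi-Civita connection form are $\theta=l_g^{-1}\frac{\omega^L+(\omega^R)^\dagger}{2}$, $\widetilde\omega=\frac{\omega^L-(\omega^R)^\dagger}{2}$, where $\omega^L,\omega^R$ are the (left-invariant) Maurer–Cartan forms of the two factors. For $u\in P$, $X\in\mathfrak m$, $[u,X]\in T_{\pi(u)}M$ is $d\pi(\xi)$ for any $\xi\in T_uP$ with $\theta(\xi)=X$; in particular $[(q,\mathbf 1),X]=2q\,l_g(X)\in T_qM$. Spinors. $\Sigma M=P\times_H\mathbb C^2$ (defining representation); $[u,X]\cdot[u,v]=[u,\gamma(X)v]$; $\langle\psi,\phi\rangle=\psi^\dagger(\gamma_0)^r\phi$; $\nabla_{\mathcal X}[s,v]=[s,dv(\mathcal X)+(s^*\widetilde\omega)(\mathcal X)v]$ for a section $s$ of $P$. $\mathcal E_0=\{+1\}$, $\mathcal E_1=\{+1,-1\}$; $\psi$ is $\epsilon$-unit if $\langle\psi,\psi\rangle=\epsilon$. An $\epsilon$-unit spinor has a unique real $(1,1)$-tensor field $A$ (its associated tensor) with $\nabla_{\mathcal X}\psi=(\sqrt{-1})^rA(\mathcal X)\cdot\psi$ for all vector fields $\mathcal X$; it is a generalized Killing spinor if $A$ is $g$-symmetric. $\mathbb 1_{+1}=(1,0)^T$, $\mathbb 1_{-1}=(0,1)^T$. Notation. $\psi^{\mathcal K^+}_\epsilon(q)=[(q,\mathbf 1),\mathbb 1_\epsilon]$, $\psi^{\mathcal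 K^-}_\epsilon(q)=[(q,\mathbf 1),q^{-1}\mathbb 1_\epsilon]$; for $Y\in\mathfrak m$, $\xi^L_Y(q)=[(q,\mathbf 1),Y]$ and $\xi^R_Y(q)=[(q,\mathbf 1),\lambda(q^{-1})Y]$. *)

theory Defs
  imports "HOL-Analysis.Analysis"
begin

text \<open>Throughout, the parameter \<open>r :: nat\<close> is meant to be 0 (the 3-sphere) or 1 (anti-de Sitter
  3-space).  \<open>M = H\<close> is a subset of the Euclidean space of complex 2x2 matrices, and smoothness and
  derivatives on \<open>M\<close> and \<open>P = H \<times> H\<close> are those of embedded submanifolds.\<close>

type_synonym cmat = "complex^2^2"
type_synonym cvec = "complex^2"

definition cadj :: "cmat \<Rightarrow> cmat" where
  "cadj A = (\<chi> i j. cnj (A $ j $ i))"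

text \<open>The elements of the index type \<open>3\<close> are \<open>0, 1, 2\<close> (with \<open>3 = 0\<close>), so the components of a vector
  of \<open>\<mm>\<close> with respect to \<open>X\<^sub>0, X\<^sub>1, X\<^sub>2\<close> are \<open>X $ 0, X $ 1, X $ 2\<close>.\<close>

definition mprod :: "nat \<Rightarrow> real^3 \<Rightarrow> real^3 \<Rightarrow> real" where
  "mprod r X Y = (-1)^r * X$0 * Y$0 + X$1 * Y$1 + X$2 * Y$2"

definition vol :: "real^3 \<Rightarrow> real^3 \<Rightarrow> real^3 \<Rightarrow> real" where
  "vol X Y Z = det (vector [X, Y, Z] :: real^3^3)"

definition gamma0 :: "nat \<Rightarrow> cmat" where
  "gamma0 r = (if r = 0 then vector [vector [\<i>, 0], vector [0, - \<i>]]
                        else vector [vector [1, 0], vector [0, -1]])"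

definition gamma1 :: cmat where
  "gamma1 = vector [vector [0, 1], vector [-1, 0]]"

definition gamma2 :: cmat where
  "gamma2 = vector [vector [0, \<i>], vector [\<i>, 0]]"

definition gam :: "nat \<Rightarrow> real^3 \<Rightarrow> cmat" where
  "gam r X = X$0 *\<^sub>R gamma0 r + X$1 *\<^sub>R gamma1 + X$2 *\<^sub>R gamma2"

text \<open>The matrix \<open>(\<gamma>\<^sub>0)\<^sup>r\<close>.\<close>

definition gamma0_pow :: "nat \<Rightarrow> cmat" where
  "gamma0_pow r = (if r = 0 then mat 1 else gamma0 r)"

text \<open>SU(2) for \<open>r = 0\<close>, SU(1,1) for \<open>r = 1\<close>, and their Lie algebras.\<close>

definition Hgrp :: "nat \<Rightarrow> cmat set" where
  "Hgrp r = {h. det h = 1 \<and> cadj h ** gamma0_pow r ** h = gamma0_pow r}"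

definition liealg :: "nat \<Rightarrow> cmat set" where
  "liealg r = {A. trace A = 0 \<and> cadj A ** gamma0_pow r + gamma0_pow r ** A = 0}"

definition lam :: "nat \<Rightarrow> cmat \<Rightarrow> real^3 \<Rightarrow> real^3" where
  "lam r h X = inv (gam r) (h ** gam r X ** matrix_inv h)"

definition lg :: "nat \<Rightarrow> real^3 \<Rightarrow> cmat" where
  "lg r X = mat (\<i>^r / 2) ** gam r X"

subsection \<open>Smoothness and differentiation on subsets of Euclidean space\<close>

primrec Ck_on :: "nat \<Rightarrow> ('a::real_normed_vector \<Rightarrow> 'b::real_normed_vector) \<Rightarrow> 'a set \<Rightarrow> bool" where
  "Ck_on 0 f U \<longleftrightarrow> continuous_on U f"
| "Ck_on (Suc k) f U \<longleftrightarrow> (\<forall>x\<in>U. f differentiable (at x)) \<and>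
     (\<forall>v. Ck_on k (\<lambda>x. frechet_derivative f (at x) v) U)"

definition smooth_on :: "'a::real_normed_vector set \<Rightarrow> ('a \<Rightarrow> 'b::real_normed_vector) \<Rightarrow> bool" where
  "smooth_on S f \<longleftrightarrow> (\<forall>p\<in>S. \<exists>W F. open W \<and> p \<in> W \<and> (\<forall>x\<in>W \<inter> S. F x = f x) \<and> (\<forall>k. Ck_on k F W))"

text \<open>Differential at \<open>q\<close> of a map defined on \<open>H\<close>.  As a linear map on the ambient matrix space the
  derivative within \<open>H\<close> is not unique; its values on vectors tangent to \<open>H\<close> at \<open>q\<close> are, and the
  differential is only ever applied to those.\<close>

definition dH :: "nat \<Rightarrow> (cmat \<Rightarrow> 'b::real_normed_vector) \<Rightarrow> cmat \<Rightarrow> cmat \<Rightarrow> 'b" where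
  "dH r f q XX = frechet_derivative f (at q within Hgrp r) XX"

subsection \<open>The space \<open>M = H\<close> and its spin bundle\<close>

definition tangent :: "nat \<Rightarrow> cmat \<Rightarrow> cmat set" where
  "tangent r q = {q ** A | A. A \<in> liealg r}"

text \<open>The metric is determined by \<open>g\<^sub>q (2 q l\<^sub>g(X), 2 q l\<^sub>g(Y)) = \<langle>X, Y\<rangle>\<close>.\<close>

definition metric_g :: "nat \<Rightarrow> cmat \<Rightarrow> cmat \<Rightarrow> cmat \<Rightarrow> real" where
  "metric_g r q XX YY = mprod r (inv (lg r) ((1/2) *\<^sub>R (matrix_inv q ** XX)))
                              (inv (lg r) ((1/2) *\<^sub>R (matrix_inv q ** YY)))"

definition vector_field :: "nat \<Rightarrow> (cmat \<Rightarrow> cmat) \<Rightarrow> bool" where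
  "vector_field r XX \<longleftrightarrow> (\<forall>q\<in>Hgrp r. XX q \<in> tangent r q) \<and> smooth_on (Hgrp r) XX"

definition tensor_field11 :: "nat \<Rightarrow> (cmat \<Rightarrow> cmat \<Rightarrow> cmat) \<Rightarrow> bool" where
  "tensor_field11 r A \<longleftrightarrow>
     (\<forall>q\<in>Hgrp r. \<forall>XX\<in>tangent r q. A q XX \<in> tangent r q) \<and>
     (\<forall>q\<in>Hgrp r. \<forall>XX\<in>tangent r q. \<forall>YY\<in>tangent r q. \<forall>a b::real.
        A q (a *\<^sub>R XX + b *\<^sub>R YY) = a *\<^sub>R A q XX + b *\<^sub>R A q YY) \<and>
     (\<forall>XX. vector_field r XX \<longrightarrow> smooth_on (Hgrp r) (\<lambda>q. A q (XX q)))"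

definition symmetric_tensor :: "nat \<Rightarrow> (cmat \<Rightarrow> cmat \<Rightarrow> cmat) \<Rightarrow> bool" where
  "symmetric_tensor r A \<longleftrightarrow>
     (\<forall>q\<in>Hgrp r. \<forall>XX\<in>tangent r q. \<forall>YY\<in>tangent r q. metric_g r q (A q XX) YY = metric_g r q XX (A q YY))"

definition Pspin :: "nat \<Rightarrow> (cmat \<times> cmat) set" where
  "Pspin r = Hgrp r \<times> Hgrp r"

definition Pproj :: "cmat \<times> cmat \<Rightarrow> cmat" where
  "Pproj u = fst u ** cadj (snd u)"

definition Pact :: "cmat \<times> cmat \<Rightarrow> cmat \<Rightarrow> cmat \<times> cmat" where
  "Pact u h = (fst u ** h, snd u ** cadj (matrix_inv h))"

definition tangentP :: "nat \<Rightarrow> cmat \<times> cmat \<Rightarrow> (cmat \<times> cmat) set" where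
  "tangentP r u = tangent r (fst u) \<times> tangent r (snd u)"

text \<open>The Maurer--Cartan forms of the two factors, the solder form and the spin connection form.\<close>

definition omegaL :: "cmat \<times> cmat \<Rightarrow> cmat \<times> cmat \<Rightarrow> cmat" where
  "omegaL u xi = matrix_inv (fst u) ** fst xi"

definition omegaR :: "cmat \<times> cmat \<Rightarrow> cmat \<times> cmat \<Rightarrow> cmat" where
  "omegaR u xi = matrix_inv (snd u) ** snd xi"

definition solder :: "nat \<Rightarrow> cmat \<times> cmat \<Rightarrow> cmat \<times> cmat \<Rightarrow> real^3" where
  "solder r u xi = inv (lg r) ((1/2) *\<^sub>R (omegaL u xi + cadj (omegaR u xi)))"

definition spin_conn :: "cmat \<times> cmat \<Rightarrow> cmat \<times> cmat \<Rightarrow> cmat" where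
  "spin_conn u xi = (1/2) *\<^sub>R (omegaL u xi - cadj (omegaR u xi))"

text \<open>The tangent vector \<open>[u, X]\<close> at \<open>\<pi>(u)\<close>.\<close>

definition tvec :: "nat \<Rightarrow> cmat \<times> cmat \<Rightarrow> real^3 \<Rightarrow> cmat" where
  "tvec r u X = (THE XX. \<exists>xi\<in>tangentP r u. solder r u xi = X \<and> XX = frechet_derivative Pproj (at u) xi)"

subsection \<open>Spinors\<close>

text \<open>A spinor, i.e. a point of \<open>\<Sigma>M = P \<times>\<^sub>H \<complex>\<^sup>2\<close>, is the set of all its representatives.  The operations
  on spinors are defined by applying the defining formula to every admissible choice of
  representatives.\<close>

type_synonym spinor = "((cmat \<times> cmat) \<times> cvec) set"

definition spin_class :: "nat \<Rightarrow> cmat \<times> cmat \<Rightarrow> cvec \<Rightarrow> spinor" where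
  "spin_class r u v = {(Pact u h, matrix_inv h *v v) | h. h \<in> Hgrp r}"

definition scale_spinor :: "complex \<Rightarrow> spinor \<Rightarrow> spinor" where
  "scale_spinor c s = {(u, c *s v) | u v. (u, v) \<in> s}"

definition clifford :: "nat \<Rightarrow> cmat \<Rightarrow> spinor \<Rightarrow> spinor" where
  "clifford r XX s = {(u, gam r X *v v) | u X v. (u, v) \<in> s \<and> tvec r u X = XX}"

definition spin_prod :: "nat \<Rightarrow> spinor \<Rightarrow> spinor \<Rightarrow> complex" where
  "spin_prod r s t = (THE c. \<exists>u v w. (u, v) \<in> s \<and> (u, w) \<in> t \<and>
     c = (\<Sum>i\<in>UNIV. cnj (v $ i) * (gamma0_pow r *v w) $ i))"

definition local_section :: "nat \<Rightarrow> cmat set \<Rightarrow> (cmat \<Rightarrow> cmat \<times> cmat) \<Rightarrow> bool" where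
  "local_section r U s \<longleftrightarrow> open U \<and> smooth_on (U \<inter> Hgrp r) s \<and>
     (\<forall>p\<in>U \<inter> Hgrp r. s p \<in> Pspin r \<and> Pproj (s p) = p)"

text \<open>\<open>\<psi> = [s, v]\<close> on the open set \<open>U \<inter> H\<close> of \<open>M\<close>.\<close>

definition local_rep ::
  "nat \<Rightarrow> (cmat \<Rightarrow> spinor) \<Rightarrow> cmat set \<Rightarrow> (cmat \<Rightarrow> cmat \<times> cmat) \<Rightarrow> (cmat \<Rightarrow> cvec) \<Rightarrow> bool" where
  "local_rep r psi U s v \<longleftrightarrow> local_section r U s \<and> smooth_on (U \<inter> Hgrp r) v \<and>
     (\<forall>p\<in>U \<inter> Hgrp r. psi p = spin_class r (s p) (v p))"

definition spinor_field :: "nat \<Rightarrow> (cmat \<Rightarrow> spinor) \<Rightarrow> bool" where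
  "spinor_field r psi \<longleftrightarrow> (\<forall>q\<in>Hgrp r. \<exists>U s v. q \<in> U \<and> local_rep r psi U s v)"

definition nabla :: "nat \<Rightarrow> (cmat \<Rightarrow> spinor) \<Rightarrow> cmat \<Rightarrow> cmat \<Rightarrow> spinor" where
  "nabla r psi q XX = (THE t. \<exists>U s v. q \<in> U \<and> local_rep r psi U s v \<and>
     t = spin_class r (s q) (dH r v q XX + spin_conn (s q) (dH r s q XX) *v v q))"

definition unit_spinor :: "nat \<Rightarrow> real \<Rightarrow> (cmat \<Rightarrow> spinor) \<Rightarrow> bool" where
  "unit_spinor r e psi \<longleftrightarrow> spinor_field r psi \<and> (\<forall>q\<in>Hgrp r. spin_prod r (psi q) (psi q) = of_real e)"

definition associated_tensor :: "nat \<Rightarrow> (cmat \<Rightarrow> spinor) \<Rightarrow> (cmat \<Rightarrow> cmat \<Rightarrow> cmat) \<Rightarrow> bool" where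
  "associated_tensor r psi A \<longleftrightarrow> tensor_field11 r A \<and>
     (\<forall>XX. vector_field r XX \<longrightarrow> (\<forall>q\<in>Hgrp r.
        nabla r psi q (XX q) = scale_spinor (\<i>^r) (clifford r (A q (XX q)) (psi q))))"

definition unit_generalized_killing :: "nat \<Rightarrow> real \<Rightarrow> (cmat \<Rightarrow> spinor) \<Rightarrow> bool" where
  "unit_generalized_killing r e psi \<longleftrightarrow> unit_spinor r e psi \<and>
     (\<exists>A. associated_tensor r psi A \<and> symmetric_tensor r A)"

subsection \<open>The spinors and vector fields of the statement\<close>

definition signs :: "nat \<Rightarrow> real set" where
  "signs r = (if r = 0 then {1} else {1, -1})"

definition one_vec :: "real \<Rightarrow> cvec" where
  "one_vec e = (if e = 1 then vector [1, 0] else vector [0, 1])"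

definition psiK_plus :: "nat \<Rightarrow> real \<Rightarrow> cmat \<Rightarrow> spinor" where
  "psiK_plus r e q = spin_class r (q, mat 1) (one_vec e)"

definition psiK_minus :: "nat \<Rightarrow> real \<Rightarrow> cmat \<Rightarrow> spinor" where
  "psiK_minus r e q = spin_class r (q, mat 1) (matrix_inv q *v one_vec e)"

definition xi_L :: "nat \<Rightarrow> real^3 \<Rightarrow> cmat \<Rightarrow> cmat" where
  "xi_L r Y q = tvec r (q, mat 1) Y"

definition xi_R :: "nat \<Rightarrow> real^3 \<Rightarrow> cmat \<Rightarrow> cmat" where
  "xi_R r Y q = tvec r (q, mat 1) (lam r (matrix_inv q) Y)"

definition eps_Y :: "nat \<Rightarrow> real^3 \<Rightarrow> real \<Rightarrow> real" where
  "eps_Y r Y e = (-1)^r * mprod r Y Y * e"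

definition psi_R :: "nat \<Rightarrow> real^3 \<Rightarrow> real \<Rightarrow> cmat \<Rightarrow> spinor" where
  "psi_R r Y e q = clifford r (xi_R r Y q) (psiK_plus r (eps_Y r Y e) q)"

definition psi_L :: "nat \<Rightarrow> real^3 \<Rightarrow> real \<Rightarrow> cmat \<Rightarrow> spinor" where
  "psi_L r Y e q = clifford r (xi_L r Y q) (psiK_minus r (eps_Y r Y e) q)"

subsection \<open>Consistency of the explicit formula for \<open>l\<^sub>g\<close>\<close>

lemma three_index: "(3::3) = 0"
  by simp

lemma lg_components:
  assumes "r \<in> {0, 1}"
  shows "lg r X = (if r = 0
     then vector [vector [Complex 0 (X$0/2), Complex (X$1/2) (X$2/2)],
                  vector [Complex (-X$1/2) (X$2/2), Complex 0 (-X$0/2)]]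
     else vector [vector [Complex 0 (X$0/2), Complex (-X$2/2) (X$1/2)],
                  vector [Complex (-X$2/2) (-X$1/2), Complex 0 (-X$0/2)]])"
  using assms
  by (auto simp: lg_def gam_def gamma0_def gamma1_def gamma2_def matrix_matrix_mult_def mat_def
      vec_eq_iff forall_2 sum_2 complex_eq_iff)

text \<open>\<open>l\<^sub>g\<close> is a linear isomorphism onto the Lie algebra, so \<open>inv (lg r)\<close> is its inverse there.\<close>

lemma inj_lg:
  assumes "r \<in> {0, 1}" shows "inj (lg r)"
proof (rule injI)
  fix X Y assume "lg r X = lg r Y"
  then have "X$0 = Y$0 \<and> X$1 = Y$1 \<and> X$2 = Y$2"
    using assms by (auto simp: lg_components vec_eq_iff forall_2 split: if_splits)
  then show "X = Y" by (simp add: vec_eq_iff forall_3 three_index)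
qed

lemma range_lg:
  assumes "r \<in> {0, 1}" shows "range (lg r) = liealg r"
proof
  show "range (lg r) \<subseteq> liealg r"
    using assms
    by (auto simp: lg_components liealg_def gamma0_pow_def gamma0_def cadj_def trace_def sum_2
        matrix_matrix_mult_def mat_def vec_eq_iff forall_2 complex_eq_iff)
  show "liealg r \<subseteq> range (lg r)"
  proof
    fix A assume A: "A \<in> liealg r"
    define X :: "real^3" where "X = (\<chi> i. if i = 0 then 2 * Im (A$1$1)
      else if i = 1 then (if r = 0 then 2 * Re (A$1$2) else 2 * Im (A$1$2))
      else (if r = 0 then 2 * Im (A$1$2) else - 2 * Re (A$1$2)))"
    have "lg r X = A"
      using A assms
      by (auto simp: X_def lg_components liealg_def gamma0_pow_def gamma0_def cadj_def trace_def
          sum_2 matrix_matrix_mult_def mat_def vec_eq_iff forall_2 complex_eq_iff)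
    then show "A \<in> range (lg r)" by blast
  qed
qed

text \<open>\<open>\<lambda>\<^sub>*(l\<^sub>g(X)) Y = X \<times> Y\<close>, where \<open>\<lambda>\<^sub>*(A) Y\<close> is characterised by \<open>\<gamma>(\<lambda>\<^sub>*(A) Y) = A \<gamma>(Y) - \<gamma>(Y) A\<close>, the
  derivative of \<open>\<gamma>(\<lambda>(h) Y) = h \<gamma>(Y) h\<^sup>-\<^sup>1\<close>, and \<open>X \<times> Y\<close> by the hypothesis on \<open>W\<close>.\<close>

lemma lg_cross:
  assumes r: "r \<in> {0, 1}" and W: "\<And>Z. mprod r W Z = vol X Y Z"
  shows "gam r W = lg r X ** gam r Y - gam r Y ** lg r X"
proof -
  have v: "vol X Y Z = Z$0 * (X$1 * Y$2 - X$2 * Y$1) + Z$1 * (X$2 * Y$0 - X$0 * Y$2)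
     + Z$2 * (X$0 * Y$1 - X$1 * Y$0)" for Z
    by (simp add: vol_def det_3 three_index vector_3[unfolded three_index] algebra_simps)
  have "W$0 = (-1)^r * (X$1 * Y$2 - X$2 * Y$1)"
    using W[of "axis 0 1"] r by (auto simp: v mprod_def axis_def)
  moreover have "W$1 = X$2 * Y$0 - X$0 * Y$2"
    using W[of "axis 1 1"] by (simp add: v mprod_def axis_def)
  moreover have "W$2 = X$0 * Y$1 - X$1 * Y$0"
    using W[of "axis 2 1"] by (simp add: v mprod_def axis_def)
  ultimately show ?thesis
    using r
    by (auto simp: lg_components gam_def gamma0_def gamma1_def gamma2_def
        matrix_matrix_mult_def vec_eq_iff forall_2 sum_2 complex_eq_iff algebra_simps)
qed

end

(* In the gauge of the section q |-> (q, 1), a spinor field is a function w : H -> C^2, and for a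
   tangent vector 2 q l_g(X) its covariant derivative is dw + l_g(X) w.  Here w is G 1_e with
   G = q^{-1} gamma(Y) q = gamma(Z), respectively gamma(Y) q^{-1} 1_e with G = gamma(Y), Z = Y.
   Since gamma(Z)^2 = -n with n = <Z,Z> = 1 or -1, the Clifford relation gives
   gamma(Z) l_g(X) = l_g(2 n <Z,X> Z - X) gamma(Z).  Moving G to the right in dw turns the
   derivative into 2 l_g(V) w = i^r gamma(V) w, where V = -3/2 X + 2 n <Z,X> Z, respectively
   V = 3/2 X - 2 n <Z,X> Z.  The tensor is determined by psi because a Clifford multiplication
   has no non-null spinor in its kernel unless it is zero. *)

theory Submission
  imports Defs
begin

subsection \<open>Smooth maps on subsets\<close>

text \<open>What separates the overview from the definitions is choice. \<open>tvec\<close>,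
  \<open>spin_prod\<close> and \<open>nabla\<close> are definite descriptions over all
  representatives, so computing in one gauge is legitimate only once independence of the frame is
  known: for the algebraic operations by equivariance, for \<open>nabla\<close> by differentiating
  an arbitrary local section. Derivatives within \<open>Hgrp r\<close> are not unique either, as it
  is a three-dimensional subset of an eight-dimensional real space; only their values on tangent
  vectors are, these being velocities of curves in \<open>Hgrp r\<close>. So a derivative may come
  from any convenient formula, but is then evaluated on tangent vectors alone. The sign in
  \<open>eps_Y\<close> has its own reason: Clifford multiplication by Y multiplies the spinor form
  by (-1)^r n, which is 1 or -1, and starting from norm \<open>eps_Y\<close> compensates for
  it.\<close>

lemma Ck_on_subset:
  assumes "Ck_on k f U" "V \<subseteq> U" shows "Ck_on k f V"
  using assms by (induction k arbitrary: f) (auto intro: continuous_on_subset)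

text \<open>Needed for the product rule, each term of which keeps one factor
  undifferentiated.\<close>

lemma Ck_on_SucD:
  assumes "Ck_on (Suc k) f U" shows "Ck_on k f U"
  using assms
proof (induction k arbitrary: f)
  case 0
  then show ?case
    by (auto intro!: continuous_at_imp_continuous_on differentiable_imp_continuous_within)
next
  case (Suc k)
  have d: "\<forall>x\<in>U. f differentiable (at x)"
    and c: "\<And>v. Ck_on (Suc k) (\<lambda>x. frechet_derivative f (at x) v) U"
    using Suc.prems unfolding Ck_on.simps(2)[of "Suc k"] by blast+
  show ?case using d Suc.IH[OF c] by simp
qed

text \<open>On an open set the functions agree near every point, so their derivatives agree as well
  and the induction can pass to them.\<close>

lemma Ck_on_cong:
  assumes "open U" "\<And>x. x \<in> U \<Longrightarrow> f x = g x" "Ck_on k f U" shows "Ck_on k g U"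
  using assms(2,3)
proof (induction k arbitrary: f g)
  case 0
  then show ?case using continuous_on_cong[of U U f g] by simp
next
  case (Suc k)
  have g: "(g has_derivative frechet_derivative f (at x)) (at x)" if "x \<in> U" for x
  proof (rule has_derivative_transform_within_open)
    show "(f has_derivative frechet_derivative f (at x)) (at x)"
      using Suc.prems that by (simp add: frechet_derivative_works)
  qed (use Suc.prems that assms(1) in auto)
  have "Ck_on k (\<lambda>x. frechet_derivative g (at x) v) U" for v
  proof (rule Suc.IH)
    show "Ck_on k (\<lambda>x. frechet_derivative f (at x) v) U" using Suc.prems by simp
    show "frechet_derivative f (at x) v = frechet_derivative g (at x) v" if "x \<in> U" for x
      by (simp add: frechet_derivative_at[OF g[OF that]])
  qed
  then show ?case using g by (simp add: differentiable_def) blast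
qed

text \<open>Replaces the chosen \<open>frechet_derivative\<close> of the definition by any explicit
  derivative; the closure rules below rest on it.\<close>

lemma Ck_on_SucI:
  assumes "open U" "\<And>x. x \<in> U \<Longrightarrow> (f has_derivative f' x) (at x)"
    and "\<And>v. Ck_on k (\<lambda>x. f' x v) U"
  shows "Ck_on (Suc k) f U"
proof -
  have "Ck_on k (\<lambda>x. frechet_derivative f (at x) v) U" for v
    by (rule Ck_on_cong[OF assms(1) _ assms(3)[of v]]) (simp add: frechet_derivative_at[OF assms(2)])
  then show ?thesis using assms(2) by (simp add: differentiable_def) blast
qed

lemma Ck_on_SucE:
  assumes "Ck_on (Suc k) f U" "x \<in> U"
  shows "(f has_derivative frechet_derivative f (at x)) (at x)"
  using assms by (simp add: frechet_derivative_works)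

lemma Ck_on_const: "open U \<Longrightarrow> Ck_on k (\<lambda>_. c) U"
proof (induction k arbitrary: c)
  case (Suc k)
  then show ?case by (intro Ck_on_SucI[where f' = "\<lambda>_ _. 0"]) auto
qed auto

lemma Ck_on_add:
  assumes "open U" "Ck_on k f U" "Ck_on k g U" shows "Ck_on k (\<lambda>x. f x + g x) U"
  using assms(2,3)
proof (induction k arbitrary: f g)
  case (Suc k)
  show ?case
    by (rule Ck_on_SucI[OF assms(1) has_derivative_add[OF Ck_on_SucE[OF Suc.prems(1)] Ck_on_SucE[OF Suc.prems(2)]]])
      (use Suc in auto)
qed (auto intro: continuous_on_add)

lemma Ck_on_ident: "open U \<Longrightarrow> Ck_on k (\<lambda>x. x) U"
  by (cases k) (auto intro!: Ck_on_SucI[where f' = "\<lambda>_ v. v"] Ck_on_const simp del: Ck_on.simps(2))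

lemma (in bounded_linear) Ck_on:
  assumes "open U" "Ck_on k g U" shows "Ck_on k (\<lambda>x. f (g x)) U"
  using assms(2)
proof (induction k arbitrary: g)
  case (Suc k)
  show ?case
    by (rule Ck_on_SucI[OF assms(1) has_derivative[OF Ck_on_SucE[OF Suc.prems]]]) (use Suc in auto)
qed (auto intro: continuous_on)

lemma (in bounded_bilinear) Ck_on:
  assumes "open U" "Ck_on k f U" "Ck_on k g U" shows "Ck_on k (\<lambda>x. prod (f x) (g x)) U"
  using assms(2,3)
proof (induction k arbitrary: f g)
  case (Suc k)
  show ?case
    by (rule Ck_on_SucI[OF assms(1) FDERIV[OF Ck_on_SucE[OF Suc.prems(1)] Ck_on_SucE[OF Suc.prems(2)]]])
      (use Suc Suc.prems[THEN Ck_on_SucD] in \<open>auto intro!: Ck_on_add[OF assms(1)]\<close>)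
qed (auto intro: continuous_on)

lemma smooth_on_globalI:
  assumes "\<And>k. Ck_on k F UNIV" "\<And>x. x \<in> S \<Longrightarrow> F x = f x" shows "smooth_on S f"
  unfolding smooth_on_def using assms by (intro ballI exI[of _ UNIV] exI[of _ F]) auto

lemma smooth_on_const: "smooth_on S (\<lambda>_. c)"
  by (rule smooth_on_globalI[of "\<lambda>_. c"]) (auto intro: Ck_on_const)

lemma smooth_on_ident: "smooth_on S (\<lambda>x. x)"
  by (rule smooth_on_globalI[of "\<lambda>x. x"]) (auto intro: Ck_on_ident)

lemma smooth_on_cong:
  assumes "\<And>x. x \<in> S \<Longrightarrow> f x = g x" "smooth_on S f" shows "smooth_on S g"
  using assms unfolding smooth_on_def by (metis IntD2)

lemma (in bounded_linear) smooth_on: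
  assumes "smooth_on S g" shows "smooth_on S (\<lambda>x. f (g x))"
  unfolding smooth_on_def
proof
  fix p assume "p \<in> S"
  then obtain W G where "open W" "p \<in> W" "\<forall>x\<in>W \<inter> S. G x = g x" "\<forall>k. Ck_on k G W"
    using assms unfolding smooth_on_def by blast
  then show "\<exists>W F. open W \<and> p \<in> W \<and> (\<forall>x\<in>W \<inter> S. F x = f (g x)) \<and> (\<forall>k. Ck_on k F W)"
    by (intro exI[of _ W] exI[of _ "\<lambda>x. f (G x)"]) (auto intro: Ck_on)
qed

lemma smooth_on_binop:
  fixes S :: "'a::real_normed_vector set"
  assumes "\<And>k F G (U :: 'a set). open U \<Longrightarrow> Ck_on k F U \<Longrightarrow> Ck_on k G U \<Longrightarrow> Ck_on k (\<lambda>x. h (F x) (G x)) U"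
    and "smooth_on S f" "smooth_on S g"
  shows "smooth_on S (\<lambda>x. h (f x) (g x))"
  unfolding smooth_on_def
proof
  fix p assume p: "p \<in> S"
  obtain W F where F: "open W" "p \<in> W" "\<forall>x\<in>W \<inter> S. F x = f x" "\<And>k. Ck_on k F W"
    using assms(2) p unfolding smooth_on_def by blast
  obtain V G where G: "open V" "p \<in> V" "\<forall>x\<in>V \<inter> S. G x = g x" "\<And>k. Ck_on k G V"
    using assms(3) p unfolding smooth_on_def by blast
  \<comment> \<open>The two local extensions live on different neighbourhoods, so the intersection
    is used.\<close>
  have "Ck_on k (\<lambda>x. h (F x) (G x)) (W \<inter> V)" for k
    using F G by (intro assms(1) Ck_on_subset[OF F(4)] Ck_on_subset[OF G(4)]) auto
  then show "\<exists>W F. open W \<and> p \<in> W \<and> (\<forall>x\<in>W \<inter> S. F x = h (f x) (g x)) \<and> (\<forall>k. Ck_on k F W)"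
    using F G by (intro exI[of _ "W \<inter> V"] exI[of _ "\<lambda>x. h (F x) (G x)"]) auto
qed

lemma smooth_on_add: "smooth_on S f \<Longrightarrow> smooth_on S g \<Longrightarrow> smooth_on S (\<lambda>x. f x + g x)"
  by (rule smooth_on_binop[OF Ck_on_add])

lemma (in bounded_bilinear) smooth_on:
  "smooth_on S f \<Longrightarrow> smooth_on S g \<Longrightarrow> smooth_on S (\<lambda>x. prod (f x) (g x))"
  by (rule smooth_on_binop[OF Ck_on])

lemma has_derivative_transform_Int_open:
  assumes "(f has_derivative f') (at q within S)" "open U" "q \<in> U" "q \<in> S" "\<And>x. x \<in> U \<inter> S \<Longrightarrow> f x = g x"
  shows "(g has_derivative f') (at q within S)"
proof (rule has_derivative_transform_eventually[OF assms(1)])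
  show "eventually (\<lambda>x. f x = g x) (at q within S)"
    unfolding eventually_at_topological using assms by (intro exI[of _ U]) auto
qed (use assms in auto)

text \<open>Local sections are smooth only on \<open>U \<inter> Hgrp r\<close>, whereas
  \<open>dH\<close> differentiates within all of \<open>Hgrp r\<close>; openness of \<open>U\<close>
  bridges the gap.\<close>

lemma smooth_on_Int_open_has_derivative:
  assumes "smooth_on (U \<inter> S) f" "open U" "q \<in> U" "q \<in> S"
  shows "(f has_derivative frechet_derivative f (at q within S)) (at q within S)"
proof -
  obtain W F where F: "open W" "q \<in> W" "\<forall>x\<in>W \<inter> (U \<inter> S). F x = f x" "\<And>k. Ck_on k F W"
    using assms unfolding smooth_on_def by blast
  have "(F has_derivative frechet_derivative F (at q)) (at q within S)"
    using Ck_on_SucE[OF F(4) F(2)] by (rule has_derivative_at_withinI)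
  then have "(f has_derivative frechet_derivative F (at q)) (at q within S)"
    by (rule has_derivative_transform_Int_open[where U = "W \<inter> U"]) (use F assms in auto)
  then show ?thesis by (auto simp: differentiable_def simp flip: frechet_derivative_works)
qed

section \<open>Matrix operations as bounded linear and bilinear maps\<close>

lemma bounded_bilinear_matrix_mult: "bounded_bilinear ((**) :: cmat \<Rightarrow> cmat \<Rightarrow> cmat)"
  unfolding bilinear_conv_bounded_bilinear[symmetric] bilinear_def
  by (auto intro!: linearI simp: vec_eq_iff matrix_matrix_mult_def sum_2 algebra_simps)

lemma bounded_bilinear_matrix_vector_mult: "bounded_bilinear ((*v) :: cmat \<Rightarrow> cvec \<Rightarrow> cvec)"
  unfolding bilinear_conv_bounded_bilinear[symmetric] bilinear_def
  by (auto intro!: linearI simp: vec_eq_iff matrix_vector_mult_def sum_2 algebra_simps)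

lemma bounded_linear_cadj: "bounded_linear cadj"
  unfolding linear_conv_bounded_linear[symmetric]
  by (auto intro!: linearI simp: vec_eq_iff cadj_def)

lemma bounded_linear_trace: "bounded_linear (trace :: cmat \<Rightarrow> complex)"
  unfolding linear_conv_bounded_linear[symmetric]
  by (auto intro!: linearI simp: trace_def sum_2 algebra_simps)

interpretation mm: bounded_bilinear "(**) :: cmat \<Rightarrow> cmat \<Rightarrow> cmat"
  by (rule bounded_bilinear_matrix_mult)
interpretation mv: bounded_bilinear "(*v) :: cmat \<Rightarrow> cvec \<Rightarrow> cvec"
  by (rule bounded_bilinear_matrix_vector_mult)
lemmas cadj_add = linear_add[OF bounded_linear.linear[OF bounded_linear_cadj]]

subsection \<open>The group \<open>H\<close> and its Lie algebra\<close>

lemma gamma0_pow_simps: "gamma0_pow r ** gamma0_pow r = mat 1" "cadj (gamma0_pow r) = gamma0_pow r"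
  by (auto simp: gamma0_pow_def gamma0_def cadj_def matrix_matrix_mult_def mat_def vec_eq_iff forall_2 sum_2)

lemma cadj_mult: "cadj (A ** B) = cadj B ** cadj A"
  by (auto simp: cadj_def matrix_matrix_mult_def vec_eq_iff mult.commute)

lemma cadj_cadj [simp]: "cadj (cadj A) = A"
  by (simp add: cadj_def)

lemma cadj_mat_1 [simp]: "cadj (mat 1) = mat 1"
  by (auto simp: cadj_def mat_def vec_eq_iff)

lemma det_cadj: "det (cadj A) = cnj (det A)"
  by (simp add: det_2 cadj_def mult.commute)

text \<open>\<open>matrix_inv\<close> is a choice among two-sided inverses; for square matrices a
  left inverse already determines it.\<close>

lemma matrix_inv_eqI:
  fixes A B :: cmat
  assumes "B ** A = mat 1" shows "matrix_inv A = B"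
proof -
  have AB: "A ** B = mat 1" using assms by (simp add: matrix_left_right_inverse)
  then have "\<exists>C. A ** C = mat 1 \<and> C ** A = mat 1" using assms by blast
  then have inv: "A ** matrix_inv A = mat 1 \<and> matrix_inv A ** A = mat 1"
    unfolding matrix_inv_def by (rule someI_ex)
  have "matrix_inv A = matrix_inv A ** A ** B"
    using AB by (simp flip: matrix_mul_assoc)
  then show ?thesis using inv by simp
qed

lemma gamma0_pow_cancel: "A ** gamma0_pow r ** gamma0_pow r = A" "gamma0_pow r ** (gamma0_pow r ** A) = A"
  by (simp add: gamma0_pow_simps flip: matrix_mul_assoc) (simp add: gamma0_pow_simps matrix_mul_assoc)

lemma Hgrp_form: "h \<in> Hgrp r \<Longrightarrow> cadj h ** gamma0_pow r ** h = gamma0_pow r"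
  by (simp add: Hgrp_def)

text \<open>On \<open>Hgrp r\<close> inversion is the restriction of a real-linear map of the matrix
  space, which later makes it smooth.\<close>

lemma Hgrp_matrix_inv_eq:
  assumes "h \<in> Hgrp r" shows "matrix_inv h = gamma0_pow r ** cadj h ** gamma0_pow r"
proof (rule matrix_inv_eqI)
  have "gamma0_pow r ** cadj h ** gamma0_pow r ** h = gamma0_pow r ** (cadj h ** gamma0_pow r ** h)"
    by (simp add: matrix_mul_assoc)
  then show "gamma0_pow r ** cadj h ** gamma0_pow r ** h = mat 1"
    by (simp add: Hgrp_form[OF assms] gamma0_pow_simps)
qed

lemma Hgrp_inv:
  assumes "h \<in> Hgrp r"
  shows "matrix_inv h ** h = mat 1" "h ** matrix_inv h = mat 1"
proof -
  show "matrix_inv h ** h = mat 1"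
    unfolding Hgrp_matrix_inv_eq[OF assms]
    using Hgrp_form[OF assms] gamma0_pow_simps(1)[of r] by (simp flip: matrix_mul_assoc)
  then show "h ** matrix_inv h = mat 1"
    by (simp add: matrix_left_right_inverse)
qed

lemma Hgrp_inv_cancel:
  assumes "h \<in> Hgrp r"
  shows "matrix_inv h ** (h ** B) = B" "h ** (matrix_inv h ** B) = B"
    "B ** matrix_inv h ** h = B" "B ** h ** matrix_inv h = B"
    "matrix_inv h *v (h *v v) = v" "h *v (matrix_inv h *v v) = v"
proof -
  show "matrix_inv h ** (h ** B) = B" "h ** (matrix_inv h ** B) = B"
    "matrix_inv h *v (h *v v) = v" "h *v (matrix_inv h *v v) = v"
    by (simp_all add: matrix_mul_assoc matrix_vector_mul_assoc Hgrp_inv[OF assms])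
  show "B ** matrix_inv h ** h = B" "B ** h ** matrix_inv h = B"
    by (simp_all add: Hgrp_inv[OF assms] flip: matrix_mul_assoc)
qed

lemma mat_1_in_Hgrp: "mat 1 \<in> Hgrp r"
  by (simp add: Hgrp_def)

lemma mult_in_Hgrp:
  assumes "h \<in> Hgrp r" "k \<in> Hgrp r" shows "h ** k \<in> Hgrp r"
proof -
  have "cadj (h ** k) ** gamma0_pow r ** (h ** k) = cadj k ** (cadj h ** gamma0_pow r ** h) ** k"
    by (simp add: cadj_mult matrix_mul_assoc)
  then show ?thesis using assms by (simp add: Hgrp_def det_mul)
qed

text \<open>With J = \<open>gamma0_pow r\<close>, the inverse of \<open>h\<close> is
  \<open>J ** cadj h ** J\<close>, so \<open>h\<close> times its inverse gives
  \<open>h ** J ** cadj h = J\<close>. The second factor of the bundle enters the projection through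
  its adjoint.\<close>

lemma cadj_in_Hgrp:
  assumes "h \<in> Hgrp r" shows "cadj h \<in> Hgrp r"
proof -
  let ?J = "gamma0_pow r"
  have "h ** ?J ** cadj h = (h ** matrix_inv h) ** ?J"
    unfolding Hgrp_matrix_inv_eq[OF assms]
    by (simp add: matrix_mul_assoc gamma0_pow_cancel)
  then show ?thesis using assms Hgrp_inv[OF assms] by (simp add: Hgrp_def det_cadj)
qed

lemma inv_in_Hgrp:
  assumes "h \<in> Hgrp r" shows "matrix_inv h \<in> Hgrp r"
proof -
  let ?J = "gamma0_pow r" and ?k = "matrix_inv h"
  have k: "cadj ?k ** cadj h = mat 1"
    by (simp add: Hgrp_inv[OF assms] flip: cadj_mult)
  have "det (?k ** h) = 1" by (simp add: Hgrp_inv[OF assms])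
  then have 1: "det ?k = 1" using assms by (simp add: det_mul Hgrp_def)
  have "cadj ?k ** ?J ** ?k = cadj ?k ** (cadj h ** ?J ** h) ** ?k"
    using assms by (simp add: Hgrp_def)
  also have "\<dots> = (cadj ?k ** cadj h) ** ?J ** (h ** ?k)"
    by (simp add: matrix_mul_assoc)
  also have "\<dots> = ?J"
    by (simp add: k Hgrp_inv[OF assms])
  finally show ?thesis using 1 by (simp add: Hgrp_def)
qed

lemma matrix_inv_cadj:
  assumes "h \<in> Hgrp r" shows "matrix_inv (cadj h) = cadj (matrix_inv h)"
  by (rule matrix_inv_eqI) (simp add: Hgrp_inv[OF assms] flip: cadj_mult)

lemma matrix_inv_matrix_inv:
  assumes "h \<in> Hgrp r" shows "matrix_inv (matrix_inv h) = h"
  by (rule matrix_inv_eqI) (rule Hgrp_inv(2)[OF assms])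

lemma matrix_inv_mult:
  assumes "h \<in> Hgrp r" "k \<in> Hgrp r" shows "matrix_inv (h ** k) = matrix_inv k ** matrix_inv h"
  by (rule matrix_inv_eqI) (simp add: matrix_mul_assoc Hgrp_inv_cancel[OF assms(1)] Hgrp_inv[OF assms(2)])

lemma matrix_inv_mat_1 [simp]: "matrix_inv (mat 1 :: cmat) = mat 1"
  by (rule matrix_inv_eqI) simp

text \<open>Pulls the form with matrix \<open>J\<close> back along \<open>B\<close>; its invariance
  under \<open>Hgrp r\<close> and its scaling under Clifford multiplication are both
  instances.\<close>

lemma hermitian_form_mult:
  fixes B J :: cmat
  shows "(\<Sum>i\<in>UNIV. cnj ((B *v v) $ i) * (J *v (B *v w)) $ i)
       = (\<Sum>i\<in>UNIV. cnj (v $ i) * ((cadj B ** J ** B) *v w) $ i)"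
proof -
  have "(\<Sum>i\<in>UNIV. cnj ((B *v v) $ i) * u $ i) = (\<Sum>i\<in>UNIV. cnj (v $ i) * (cadj B *v u) $ i)" for u :: cvec
    by (simp add: sum_2 matrix_vector_mult_def cadj_def algebra_simps)
  then show ?thesis by (simp add: matrix_vector_mul_assoc matrix_mul_assoc)
qed

lemma Hgrp_form_invariant:
  assumes "h \<in> Hgrp r"
  shows "(\<Sum>i\<in>UNIV. cnj ((h *v v) $ i) * (gamma0_pow r *v (h *v w)) $ i)
       = (\<Sum>i\<in>UNIV. cnj (v $ i) * (gamma0_pow r *v w) $ i)"
  unfolding hermitian_form_mult Hgrp_form[OF assms] ..

subsection \<open>Clifford multiplication\<close>

lemma bounded_linear_lg: assumes "r \<in> {0, 1}" shows "bounded_linear (lg r)"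
  unfolding linear_conv_bounded_linear[symmetric] using assms
  by (auto intro!: linearI simp: lg_components vec_eq_iff forall_2 complex_eq_iff field_simps)

text \<open>Absorbs the factor i^r of the Killing equation, so that both sides can be compared
  inside the image of \<open>lg r\<close>.\<close>

lemma i_gam: "r \<in> {0, 1} \<Longrightarrow> mat (\<i>^r) ** gam r X = 2 *\<^sub>R lg r X"
  by (auto simp: lg_components gam_def gamma0_def gamma1_def gamma2_def matrix_matrix_mult_def mat_def
    vec_eq_iff forall_2 sum_2 complex_eq_iff)

lemma gam_eq_lg:
  assumes "r \<in> {0, 1}" shows "gam r X = mat (2 / \<i>^r) ** lg r X"
  using assms by (auto simp: lg_def matrix_mul_assoc matrix_matrix_mult_def mat_def vec_eq_iff
      forall_2 sum_2 complex_eq_iff)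

lemma inj_gam: assumes "r \<in> {0, 1}" shows "inj (gam r)"
  using inj_lg[OF assms] by (auto simp: inj_def lg_def)

text \<open>The Clifford relation YX = -XY - 2<X,Y>, multiplied by Y on the right. The two-sided
  product stays in the image of \<open>lg r\<close>, while a one-sided one has a scalar part in
  general.\<close>

lemma gam_lg_gam:
  assumes "r \<in> {0, 1}"
  shows "gam r Y ** lg r X ** gam r Y = lg r (mprod r Y Y *\<^sub>R X - (2 * mprod r X Y) *\<^sub>R Y)"
  using assms
  by (auto simp: lg_components gam_def gamma0_def gamma1_def gamma2_def mprod_def
        matrix_matrix_mult_def vec_eq_iff forall_2 sum_2 complex_eq_iff) (simp_all add: field_simps)

lemma gam_square:
  assumes "r \<in> {0, 1}"
  shows "gam r Y ** gam r Y = (- mprod r Y Y) *\<^sub>R mat 1"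
  using assms
  by (auto simp: gam_def gamma0_def gamma1_def gamma2_def mprod_def mat_def
        matrix_matrix_mult_def vec_eq_iff forall_2 sum_2 complex_eq_iff algebra_simps)

text \<open>\<open>gam r Y\<close> is skew-adjoint for the spinor form if r = 0 and self-adjoint if
  r = 1, and its square is a scalar.\<close>

lemma gam_form:
  assumes "r \<in> {0, 1}"
  shows "cadj (gam r Y) ** gamma0_pow r ** gam r Y = ((-1)^r * mprod r Y Y) *\<^sub>R gamma0_pow r"
proof -
  have "cadj (gam r Y) ** gamma0_pow r = (- ((-1)^r)) *\<^sub>R (gamma0_pow r ** gam r Y)"
    using assms
    by (auto simp: gam_def gamma0_def gamma1_def gamma2_def mat_def cadj_def gamma0_pow_def
        matrix_matrix_mult_def vec_eq_iff forall_2 sum_2 complex_eq_iff)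
  then show ?thesis
    by (simp add: mm.scaleR_left mm.scaleR_right mm.minus_left mm.minus_right gam_square[OF assms] flip: matrix_mul_assoc)
qed

text \<open>The trace form is invariant under conjugation, which makes \<open>lam r h\<close> an
  isometry, and it describes the metric without \<open>inv (lg r)\<close>, which makes smoothness
  visible.\<close>

lemma mprod_trace:
  assumes "r \<in> {0, 1}"
  shows "mprod r X Y = - 2 * (-1)^r * Re (trace (lg r X ** lg r Y))"
  using assms
  by (auto simp: lg_components trace_def mprod_def matrix_matrix_mult_def sum_2 field_simps)

lemma lg_square:
  assumes "r \<in> {0, 1}"
  shows "lg r X ** lg r X = (- ((-1)^r * mprod r X X / 4)) *\<^sub>R mat 1"
  using assms
  by (auto simp: lg_components mprod_def mat_def
        matrix_matrix_mult_def vec_eq_iff forall_2 sum_2 complex_eq_iff field_simps)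

lemma lg_in_liealg: "r \<in> {0, 1} \<Longrightarrow> lg r X \<in> liealg r"
  using range_lg by blast

lemma conj_in_liealg:
  assumes "h \<in> Hgrp r" "A \<in> liealg r" shows "h ** A ** matrix_inv h \<in> liealg r"
proof -
  let ?J = "gamma0_pow r" and ?k = "matrix_inv h"
  have "cadj ?k ** (cadj A ** ?J + ?J ** A) ** ?k = 0"
    using assms(2) by (simp add: liealg_def)
  then have 1: "cadj ?k ** cadj A ** ?J ** ?k + cadj ?k ** ?J ** A ** ?k = 0"
    by (simp add: mm.add_left mm.add_right matrix_mul_assoc)
  have 2: "cadj ?k ** ?J = ?J ** h"
    using arg_cong[OF Hgrp_matrix_inv_eq[OF assms(1)], of cadj]
    by (simp add: cadj_mult gamma0_pow_simps gamma0_pow_cancel matrix_mul_assoc)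
  have 3: "cadj h ** ?J = ?J ** ?k"
    using Hgrp_matrix_inv_eq[OF assms(1)]
    by (simp add: gamma0_pow_cancel flip: matrix_mul_assoc)
  have "cadj (h ** A ** ?k) ** ?J + ?J ** (h ** A ** ?k)
      = cadj ?k ** cadj A ** (cadj h ** ?J) + (?J ** h) ** A ** ?k"
    by (simp add: cadj_mult matrix_mul_assoc)
  also have "\<dots> = 0" using 1 unfolding 3 2[symmetric] by (simp add: matrix_mul_assoc)
  finally have "cadj (h ** A ** ?k) ** ?J + ?J ** (h ** A ** ?k) = 0" .
  moreover have "trace (h ** A ** ?k) = trace A"
    by (subst trace_mul_sym) (simp add: matrix_mul_assoc Hgrp_inv[OF assms(1)])
  ultimately show ?thesis using assms(2) by (simp add: liealg_def)
qed

lemma cadj_in_liealg: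
  assumes "A \<in> liealg r" shows "cadj A \<in> liealg r"
proof -
  let ?J = "gamma0_pow r"
  have "?J ** (cadj A ** ?J + ?J ** A) ** ?J = 0"
    using assms by (simp add: liealg_def)
  then have "A ** ?J + ?J ** cadj A = 0"
    by (simp add: mm.add_left mm.add_right matrix_mul_assoc gamma0_pow_simps gamma0_pow_cancel add.commute)
  moreover have "trace (cadj A) = cnj (trace A)"
    by (simp add: trace_def cadj_def)
  ultimately show ?thesis using assms by (simp add: liealg_def)
qed

text \<open>\<open>lam\<close> is defined through \<open>inv (gam r)\<close>, so it must be shown
  that conjugation keeps the range of \<open>gam r\<close>. This follows from the invariance of the
  Lie algebra, as \<open>gam r\<close> and \<open>lg r\<close> differ by a scalar factor.\<close>

lemma lg_lam:
  assumes "r \<in> {0, 1}" "h \<in> Hgrp r"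
  shows "lg r (lam r h X) = h ** lg r X ** matrix_inv h"
    and "gam r (lam r h X) = h ** gam r X ** matrix_inv h"
proof -
  have comm: "A ** mat c = mat c ** A" for A :: cmat and c
    by (auto simp: matrix_matrix_mult_def mat_def vec_eq_iff forall_2 sum_2)
  have "h ** lg r X ** matrix_inv h \<in> range (lg r)"
    using assms conj_in_liealg lg_in_liealg range_lg by blast
  then obtain Z where Z: "lg r Z = h ** lg r X ** matrix_inv h" by force
  have gamZ: "gam r Z = h ** gam r X ** matrix_inv h"
    by (simp add: gam_eq_lg[OF assms(1)] Z matrix_mul_assoc comm[of h])
  then have "lam r h X = Z" using inj_gam[OF assms(1)] by (simp add: lam_def inv_f_eq)
  then show "lg r (lam r h X) = h ** lg r X ** matrix_inv h"
    and "gam r (lam r h X) = h ** gam r X ** matrix_inv h"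
    using Z gamZ by auto
qed

lemma mprod_lam:
  assumes "r \<in> {0, 1}" "h \<in> Hgrp r"
  shows "mprod r (lam r h X) (lam r h Y) = mprod r X Y"
proof -
  have "trace (lg r (lam r h X) ** lg r (lam r h Y)) = trace (h ** (lg r X ** lg r Y ** matrix_inv h))"
    by (simp add: lg_lam[OF assms] matrix_mul_assoc Hgrp_inv_cancel[OF assms(2)])
  also have "\<dots> = trace (lg r X ** lg r Y)"
    by (subst trace_mul_sym) (simp add: Hgrp_inv_cancel[OF assms(2)])
  finally show ?thesis by (simp add: mprod_trace[OF assms(1)])
qed

subsection \<open>Tangent vectors of \<open>H\<close>\<close>

lemma liealg_half_add:
  assumes "r \<in> {0, 1}" "A \<in> liealg r" "B \<in> liealg r"
  shows "(1/2) *\<^sub>R (A + B) \<in> liealg r"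
proof -
  interpret lg: bounded_linear "lg r" by (rule bounded_linear_lg[OF assms(1)])
  obtain X Z where "A = lg r X" "B = lg r Z"
    using assms(2,3) unfolding range_lg[OF assms(1), symmetric] by blast
  then have "(1/2) *\<^sub>R (A + B) = lg r ((1/2) *\<^sub>R (X + Z))" by (simp add: lg.add lg.scaleR)
  then show ?thesis using lg_in_liealg[OF assms(1)] by simp
qed

lemma Pproj_has_derivative:
  "(Pproj has_derivative (\<lambda>xi. fst u ** cadj (snd xi) + fst xi ** cadj (snd u))) (at u)"
  unfolding Pproj_def
  by (intro mm.FDERIV bounded_linear.has_derivative[OF bounded_linear_cadj] has_derivative_fst
      has_derivative_snd has_derivative_ident)

text \<open>For xi = (aA, bB) the projection has derivative a(A +
  \<open>cadj B\<close>)(\<open>cadj b\<close>), which depends only on A + \<open>cadj B\<close>,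
  that is, on the solder form. Hence the description is well-defined.\<close>

lemma tvec_eq:
  assumes r: "r \<in> {0, 1}" and u: "a \<in> Hgrp r" "b \<in> Hgrp r"
  shows "tvec r (a, b) X = 2 *\<^sub>R (a ** lg r X ** cadj b)"
  unfolding tvec_def frechet_derivative_at[OF Pproj_has_derivative, symmetric]
proof (rule the_equality)
  interpret lg: bounded_linear "lg r" by (rule bounded_linear_lg[OF r])
  have 0: "cadj 0 = 0" "(0 :: cmat) \<in> liealg r"
    by (simp_all add: linear_0[OF bounded_linear.linear[OF bounded_linear_cadj]] liealg_def trace_def)
  \<comment> \<open>Any lift will do; moving only the first factor requires the doubled
    \<open>lg r X\<close>, because the solder form takes half of the sum.\<close>
  let ?xi = "(a ** (2 *\<^sub>R lg r X), 0 :: cmat)"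
  have "2 *\<^sub>R lg r X \<in> liealg r"
    using lg_in_liealg[OF r, of "2 *\<^sub>R X"] by (simp add: lg.scaleR)
  then have "?xi \<in> tangentP r (a, b)"
    using 0 by (auto simp: tangentP_def tangent_def intro: exI[of _ "0 :: cmat"])
  moreover have "solder r (a, b) ?xi = X"
    using inj_lg[OF r] by (simp add: solder_def omegaL_def omegaR_def Hgrp_inv_cancel[OF u(1)] 0)
  ultimately show "\<exists>xi\<in>tangentP r (a, b). solder r (a, b) xi = X \<and> 2 *\<^sub>R (a ** lg r X ** cadj b) =
      fst (a, b) ** cadj (snd xi) + fst xi ** cadj (snd (a, b))"
    by (intro bexI[of _ ?xi]) (simp_all add: 0 mm.scaleR_left mm.scaleR_right)
next
  fix XX assume "\<exists>xi\<in>tangentP r (a, b). solder r (a, b) xi = X \<and>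
      XX = fst (a, b) ** cadj (snd xi) + fst xi ** cadj (snd (a, b))"
  then obtain A B where AB: "A \<in> liealg r" "B \<in> liealg r" "solder r (a, b) (a ** A, b ** B) = X"
    "XX = a ** cadj (b ** B) + a ** A ** cadj b"
    by (auto simp: tangentP_def tangent_def)
  have "(1/2) *\<^sub>R (A + cadj B) \<in> range (lg r)"
    using liealg_half_add[OF r AB(1) cadj_in_liealg[OF AB(2)]] range_lg[OF r] by simp
  moreover have "inv (lg r) ((1/2) *\<^sub>R (A + cadj B)) = X"
    using AB(3) by (simp add: solder_def omegaL_def omegaR_def Hgrp_inv_cancel[OF u(1)] Hgrp_inv_cancel[OF u(2)])
  ultimately have "lg r X = (1/2) *\<^sub>R (A + cadj B)" using f_inv_into_f by metis
  then show "XX = 2 *\<^sub>R (a ** lg r X ** cadj b)"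
    by (simp add: AB(4) cadj_mult mm.scaleR_left mm.scaleR_right mm.add_left mm.add_right matrix_mul_assoc)
qed

lemma tvec_global_section:
  assumes "r \<in> {0, 1}" "q \<in> Hgrp r" shows "tvec r (q, mat 1) X = 2 *\<^sub>R (q ** lg r X)"
  by (simp add: tvec_eq[OF assms mat_1_in_Hgrp])

lemma tangent_eq_range_tvec:
  assumes "r \<in> {0, 1}" "q \<in> Hgrp r" shows "tangent r q = range (tvec r (q, mat 1))"
proof -
  interpret lg: bounded_linear "lg r" by (rule bounded_linear_lg[OF assms(1)])
  have 1: "q ** lg r X = tvec r (q, mat 1) ((1/2) *\<^sub>R X)" for X
    by (simp add: tvec_global_section[OF assms] lg.scaleR mm.scaleR_right)
  have 2: "tvec r (q, mat 1) X = q ** lg r (2 *\<^sub>R X)" for X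
    by (simp add: tvec_global_section[OF assms] lg.scaleR mm.scaleR_right)
  have "tangent r q = range (\<lambda>X. q ** lg r X)"
    by (auto simp: tangent_def simp flip: range_lg[OF assms(1)])
  also have "\<dots> = range (tvec r (q, mat 1))"
    using 1 2 by (intro equalityI image_subsetI) (metis rangeI)+
  finally show ?thesis .
qed

lemma bounded_linear_tvec:
  assumes "r \<in> {0, 1}" "q \<in> Hgrp r" shows "bounded_linear (tvec r (q, mat 1))"
proof -
  have "tvec r (q, mat 1) = (\<lambda>X. 2 *\<^sub>R (q ** lg r X))" by (simp add: fun_eq_iff tvec_global_section[OF assms])
  then show ?thesis
    by (simp add: bounded_linear_scaleR_right[THEN bounded_linear_compose] mm.bounded_linear_right[THEN bounded_linear_compose] bounded_linear_lg[OF assms(1)])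
qed

lemma inv_mult_tvec:
  assumes "r \<in> {0, 1}" "q \<in> Hgrp r" shows "matrix_inv q ** tvec r (q, mat 1) X = 2 *\<^sub>R lg r X"
  by (simp add: tvec_global_section[OF assms] mm.scaleR_right Hgrp_inv_cancel[OF assms(2)])

lemma inj_tvec:
  assumes "r \<in> {0, 1}" "q \<in> Hgrp r" shows "inj (tvec r (q, mat 1))"
proof (rule injI)
  fix X Z assume "tvec r (q, mat 1) X = tvec r (q, mat 1) Z"
  then have "matrix_inv q ** tvec r (q, mat 1) X = matrix_inv q ** tvec r (q, mat 1) Z" by simp
  then show "X = Z" using inj_lg[OF assms(1)] by (simp add: inv_mult_tvec[OF assms] inj_eq)
qed

lemma metric_g_tvec:
  assumes "r \<in> {0, 1}" "q \<in> Hgrp r"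
  shows "metric_g r q (tvec r (q, mat 1) X) (tvec r (q, mat 1) Z) = mprod r X Z"
  using inj_lg[OF assms(1)] by (simp add: metric_g_def inv_mult_tvec[OF assms])

text \<open>\<open>A = lg r X\<close> is skew for the form, so the adjoint turns \<alpha> + \<beta>
  A into \<alpha> - \<beta> A. As A squares to a scalar, the product of the two is a scalar too, and
  it equals the determinant: one equation settles both conditions.\<close>

lemma lg_curve_in_Hgrp:
  assumes r: "r \<in> {0, 1}" and "\<alpha>^2 + \<beta>^2 * ((-1)^r * mprod r X X / 4) = 1"
  shows "\<alpha> *\<^sub>R mat 1 + \<beta> *\<^sub>R lg r X \<in> Hgrp r"
proof -
  let ?J = "gamma0_pow r" and ?A = "lg r X"
  have det: "det (\<alpha> *\<^sub>R mat 1 + \<beta> *\<^sub>R lg r X) = of_real (\<alpha>^2 + \<beta>^2 * ((-1)^r * mprod r X X / 4))"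
    using r by (auto simp: det_2 lg_components mprod_def mat_def complex_eq_iff power2_eq_square field_simps)
  have A: "cadj ?A ** ?J = - (?J ** ?A)"
    using lg_in_liealg[OF r] by (simp add: liealg_def eq_neg_iff_add_eq_0)
  have c: "cadj (c *\<^sub>R B) = c *\<^sub>R cadj B" for c B
    by (rule linear_scale[OF bounded_linear.linear[OF bounded_linear_cadj]])
  have "cadj (\<alpha> *\<^sub>R mat 1 + \<beta> *\<^sub>R ?A) ** ?J = ?J ** (\<alpha> *\<^sub>R mat 1 - \<beta> *\<^sub>R ?A)"
    by (simp add: cadj_add c mm.add_left mm.diff_right mm.scaleR_left mm.scaleR_right A)
  then have "cadj (\<alpha> *\<^sub>R mat 1 + \<beta> *\<^sub>R ?A) ** ?J ** (\<alpha> *\<^sub>R mat 1 + \<beta> *\<^sub>R ?A)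
      = ?J ** ((\<alpha> *\<^sub>R mat 1 - \<beta> *\<^sub>R ?A) ** (\<alpha> *\<^sub>R mat 1 + \<beta> *\<^sub>R ?A))"
    by (simp add: matrix_mul_assoc)
  also have "(\<alpha> *\<^sub>R mat 1 - \<beta> *\<^sub>R ?A) ** (\<alpha> *\<^sub>R mat 1 + \<beta> *\<^sub>R ?A) = (\<alpha>^2) *\<^sub>R mat 1 - (\<beta>^2) *\<^sub>R (?A ** ?A)"
    by (simp add: mm.add_left mm.add_right mm.diff_left mm.diff_right mm.scaleR_left mm.scaleR_right
        power2_eq_square algebra_simps)
  also have "\<dots> = (\<alpha>^2 + \<beta>^2 * ((-1)^r * mprod r X X / 4)) *\<^sub>R mat 1"
    unfolding lg_square[OF r] by (simp add: scaleR_add_left)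
  finally show ?thesis using det unfolding assms(2) by (simp add: Hgrp_def)
qed

text \<open>Two derivatives within \<open>H\<close> agree on \<open>q l\<^sub>g(X)\<close> because it is the velocity of a curve in \<open>H\<close>;
  as \<open>l\<^sub>g(X)\<^sup>2\<close> is a scalar, \<open>q (\<alpha> + t l\<^sub>g(X))\<close> with \<open>\<alpha>\<close> normalising the determinant is such a curve.\<close>

lemma derivative_within_Hgrp_unique:
  assumes r: "r \<in> {0, 1}" and q: "q \<in> Hgrp r" and XX: "XX \<in> tangent r q"
    and f: "(f has_derivative f') (at q within Hgrp r)" "(f has_derivative f'') (at q within Hgrp r)"
  shows "f' XX = f'' XX"
proof -
  obtain A where A: "A \<in> range (lg r)" "XX = q ** A"
    using XX unfolding tangent_def range_lg[OF r] by blast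
  then obtain X where X: "XX = q ** lg r X" by blast
  \<comment> \<open>The determinant of \<open>lg r X\<close>, so \<open>lg r X\<close> has square
    -d.\<close>
  define d where "d = (-1)^r * mprod r X X / 4"
  define S where "S = {t::real. 1 - t^2 * d > 0}"
  define c where "c = (\<lambda>t. q ** (sqrt (1 - t^2 * d) *\<^sub>R mat 1 + t *\<^sub>R lg r X))"
  have S: "open S" "0 \<in> S" unfolding S_def by (auto intro!: open_Collect_less continuous_intros)
  have c0: "c 0 = q" by (simp add: c_def)
  \<comment> \<open>The normalising factor is stationary at 0, so the velocity of \<open>c\<close>
    there is exactly \<open>XX\<close>.\<close>
  have "((\<lambda>t. sqrt (1 - t^2 * d)) has_derivative (\<lambda>t. 0)) (at 0)"
    by (auto intro!: derivative_eq_intros)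
  then have "(c has_derivative (\<lambda>t. q ** (0 *\<^sub>R mat 1 + t *\<^sub>R lg r X))) (at 0)"
    unfolding c_def by (intro mm.bounded_linear_right[THEN bounded_linear.has_derivative] has_derivative_add
       has_derivative_scaleR_left has_derivative_ident)
  then have c: "(c has_derivative (\<lambda>t. t *\<^sub>R XX)) (at 0 within S)"
    by (simp add: X mm.scaleR_right has_derivative_at_withinI)
  have cS: "c ` S \<subseteq> Hgrp r"
  proof (rule image_subsetI)
    fix t assume "t \<in> S"
    then have "(sqrt (1 - t^2 * d))^2 + t^2 * ((-1)^r * mprod r X X / 4) = 1"
      by (simp add: S_def d_def)
    then show "c t \<in> Hgrp r"
      unfolding c_def by (intro mult_in_Hgrp[OF q] lg_curve_in_Hgrp[OF r])
  qed
  have compose: "((\<lambda>t. f (c t)) has_derivative (\<lambda>t. g (t *\<^sub>R XX))) (at 0)"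
    if "(f has_derivative g) (at q within Hgrp r)" for g
  proof -
    have "(f has_derivative g) (at (c 0) within c ` S)"
      unfolding c0 by (rule has_derivative_subset[OF that cS])
    from has_derivative_in_compose[OF c this] show ?thesis
      by (simp only: at_within_open[OF S(2,1)])
  qed
  show ?thesis
    using fun_cong[OF has_derivative_unique[OF compose[OF f(1)] compose[OF f(2)]], of 1] by simp
qed

text \<open>\<open>dH\<close> uses one chosen derivative; on tangent vectors every derivative within
  \<open>Hgrp r\<close> gives the same value.\<close>

lemma dH_eq:
  assumes "r \<in> {0, 1}" "q \<in> Hgrp r" "XX \<in> tangent r q"
    and "(f has_derivative f') (at q within Hgrp r)"
  shows "dH r f q XX = f' XX"
proof -
  have "(f has_derivative frechet_derivative f (at q within Hgrp r)) (at q within Hgrp r)"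
    using assms(4) by (auto simp: differentiable_def simp flip: frechet_derivative_works)
  from derivative_within_Hgrp_unique[OF assms(1-3) this assms(4)] show ?thesis by (simp add: dH_def)
qed

subsection \<open>Spinors in the global gauge\<close>

lemma spin_class_Pact:
  assumes "h \<in> Hgrp r"
  shows "spin_class r (Pact u h) (matrix_inv h *v v) = spin_class r u v"
proof -
  have Pact: "Pact (Pact u h) k = Pact u (h ** k)" "matrix_inv k *v (matrix_inv h *v v) = matrix_inv (h ** k) *v v"
    if "k \<in> Hgrp r" for k
    using assms that by (simp_all add: Pact_def matrix_inv_mult cadj_mult matrix_mul_assoc matrix_vector_mul_assoc)
  have "\<exists>k'. k' \<in> Hgrp r \<and> k = h ** k'" if "k \<in> Hgrp r" for k
    using mult_in_Hgrp[OF inv_in_Hgrp[OF assms] that] Hgrp_inv_cancel(2)[OF assms] by metis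
  then show ?thesis
    using mult_in_Hgrp[OF assms] by (auto simp: spin_class_def Pact) (metis Pact)
qed

text \<open>The action on the bundle is free, so a class contains exactly one vector over each of
  its frames.\<close>

lemma mem_spin_class_iff:
  assumes "fst u \<in> Hgrp r" shows "(u, w) \<in> spin_class r u v \<longleftrightarrow> w = v"
proof
  assume "(u, w) \<in> spin_class r u v"
  then obtain h where h: "h \<in> Hgrp r" "u = Pact u h" "w = matrix_inv h *v v" by (auto simp: spin_class_def)
  have "matrix_inv (fst u) ** fst u = matrix_inv (fst u) ** (fst u ** h)"
    using arg_cong[OF h(2), of fst] by (simp add: Pact_def)
  then have "h = mat 1" by (simp add: Hgrp_inv_cancel[OF assms] Hgrp_inv[OF assms])
  then show "w = v" using h by simp
next
  have "Pact u (mat 1) = u" by (simp add: Pact_def)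
  moreover assume "w = v"
  ultimately show "(u, w) \<in> spin_class r u v" using mat_1_in_Hgrp
    by (force simp: spin_class_def)
qed

lemma spin_class_inject:
  assumes "fst u \<in> Hgrp r" shows "spin_class r u v = spin_class r u w \<longleftrightarrow> v = w"
  using mem_spin_class_iff[OF assms] by blast

text \<open>The frame (a, b) is the global frame over the same point acted on by the inverse of
  \<open>cadj b\<close>.\<close>

lemma spin_class_global_gauge:
  assumes "a \<in> Hgrp r" "b \<in> Hgrp r"
  shows "spin_class r (a, b) (cadj b *v v) = spin_class r (a ** cadj b, mat 1) v"
proof -
  have b: "cadj b \<in> Hgrp r" by (rule cadj_in_Hgrp[OF assms(2)])
  have "Pact (a ** cadj b, mat 1) (matrix_inv (cadj b)) = (a, b)"
    by (simp add: Pact_def matrix_inv_matrix_inv[OF b] Hgrp_inv_cancel[OF b])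
  then show ?thesis
    using spin_class_Pact[OF inv_in_Hgrp[OF b], of "(a ** cadj b, mat 1)" v]
    by (simp add: matrix_inv_matrix_inv[OF b])
qed

lemma scale_spinor_class: "scale_spinor c (spin_class r u v) = spin_class r u (c *s v)"
proof -
  have "A *v (c *s v) = c *s (A *v v)" for A :: cmat
    by (simp add: vec_eq_iff matrix_vector_mult_def sum_2 algebra_simps)
  then show ?thesis by (auto simp: scale_spinor_def spin_class_def)
qed

text \<open>A common frame forces the same group element for both representatives, and that element
  preserves the form.\<close>

lemma spin_prod_class:
  assumes "fst u \<in> Hgrp r"
  shows "spin_prod r (spin_class r u v) (spin_class r u w) =
    (\<Sum>i\<in>UNIV. cnj (v $ i) * (gamma0_pow r *v w) $ i)"
  unfolding spin_prod_def
proof (rule the_equality)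
  show "\<exists>u' v' w'. (u', v') \<in> spin_class r u v \<and> (u', w') \<in> spin_class r u w \<and>
    (\<Sum>i\<in>UNIV. cnj (v $ i) * (gamma0_pow r *v w) $ i) = (\<Sum>i\<in>UNIV. cnj (v' $ i) * (gamma0_pow r *v w') $ i)"
    using mem_spin_class_iff[OF assms] by blast
next
  fix c assume "\<exists>u' v' w'. (u', v') \<in> spin_class r u v \<and> (u', w') \<in> spin_class r u w \<and>
    c = (\<Sum>i\<in>UNIV. cnj (v' $ i) * (gamma0_pow r *v w') $ i)"
  then obtain u' v' w' where *: "(u', v') \<in> spin_class r u v" "(u', w') \<in> spin_class r u w"
    "c = (\<Sum>i\<in>UNIV. cnj (v' $ i) * (gamma0_pow r *v w') $ i)" by blast
  then obtain h k where hk: "h \<in> Hgrp r" "k \<in> Hgrp r" "u' = Pact u h" "u' = Pact u k"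
    "v' = matrix_inv h *v v" "w' = matrix_inv k *v w"
    by (auto simp: spin_class_def)
  have "fst u ** h = fst u ** k" using hk by (simp add: Pact_def)
  then have "matrix_inv (fst u) ** (fst u ** h) = matrix_inv (fst u) ** (fst u ** k)" by simp
  then have "h = k" by (simp add: Hgrp_inv_cancel[OF assms])
  then show "c = (\<Sum>i\<in>UNIV. cnj (v $ i) * (gamma0_pow r *v w) $ i)"
    using * hk Hgrp_form_invariant[OF inv_in_Hgrp] by simp
qed

lemma clifford_global_gauge:
  assumes r: "r \<in> {0, 1}" and q: "q \<in> Hgrp r"
  shows "clifford r (tvec r (q, mat 1) X) (spin_class r (q, mat 1) v) = spin_class r (q, mat 1) (gam r X *v v)"
proof -
  \<comment> \<open>Over the frame moved by \<open>h\<close>, the same tangent vector has components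
    transformed by the inverse of \<open>h\<close>; \<open>gm\<close> is the matching equivariance
    of Clifford multiplication.\<close>
  have tv: "tvec r (Pact (q, mat 1) h) Z = tvec r (q, mat 1) X \<longleftrightarrow> Z = lam r (matrix_inv h) X"
    if h: "h \<in> Hgrp r" for h Z
  proof -
    have k: "matrix_inv h \<in> Hgrp r" by (rule inv_in_Hgrp[OF h])
    have "tvec r (Pact (q, mat 1) h) Z = 2 *\<^sub>R (q ** (h ** lg r Z ** matrix_inv h))"
      by (simp add: Pact_def tvec_eq[OF r mult_in_Hgrp[OF q h] cadj_in_Hgrp[OF k]] matrix_mul_assoc)
    also have "\<dots> = tvec r (q, mat 1) (lam r h Z)"
      by (simp add: tvec_global_section[OF r q] lg_lam[OF r h])
    finally have "tvec r (Pact (q, mat 1) h) Z = tvec r (q, mat 1) X \<longleftrightarrow> lam r h Z = X"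
      by (simp add: inj_eq[OF inj_tvec[OF r q]])
    also have "\<dots> \<longleftrightarrow> lg r (lam r h Z) = lg r X" by (simp add: inj_eq[OF inj_lg[OF r]])
    also have "\<dots> \<longleftrightarrow> lg r Z = lg r (lam r (matrix_inv h) X)"
      by (auto simp: lg_lam[OF r h] lg_lam[OF r k] matrix_inv_matrix_inv[OF h] matrix_mul_assoc Hgrp_inv[OF h] Hgrp_inv_cancel[OF h]
         dest: sym)
    finally show ?thesis by (simp add: inj_eq[OF inj_lg[OF r]])
  qed
  have gm: "gam r (lam r (matrix_inv h) X) *v (matrix_inv h *v v) = matrix_inv h *v (gam r X *v v)"
    if h: "h \<in> Hgrp r" for h
    by (simp add: lg_lam[OF r inv_in_Hgrp[OF h]] matrix_inv_matrix_inv[OF h] matrix_vector_mul_assoc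
        Hgrp_inv_cancel[OF h])
  show ?thesis
    unfolding clifford_def spin_class_def using tv gm by (auto, metis+)
qed

subsection \<open>The covariant derivative in the global gauge\<close>

lemma local_rep_global_section:
  assumes "\<And>p. p \<in> Hgrp r \<Longrightarrow> psi p = spin_class r (p, mat 1) (w p)" "smooth_on (Hgrp r) w"
  shows "local_rep r psi UNIV (\<lambda>p. (p, mat 1)) w"
proof -
  have "bounded_linear (\<lambda>x. (x, 0) :: cmat \<times> cmat)"
    by (intro bounded_linear_Pair bounded_linear_ident bounded_linear_zero)
  from smooth_on_add[OF bounded_linear.smooth_on[OF this smooth_on_ident] smooth_on_const[of _ "(0, mat 1)"]]
  show ?thesis
    using assms mat_1_in_Hgrp by (simp add: local_rep_def local_section_def Pspin_def Pproj_def)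
qed

text \<open>Gauge independence: a local representative \<open>(s, v)\<close> with \<open>s = (a, b)\<close> satisfies \<open>a b\<^sup>\<dagger> = p\<close> and
  \<open>v = b\<^sup>\<dagger> w\<close>; differentiating both identities makes the terms in the derivative of \<open>b\<close> cancel.\<close>

lemma nabla_global_gauge:
  assumes r: "r \<in> {0, 1}" and q: "q \<in> Hgrp r" and XX: "XX \<in> tangent r q"
    and psi: "\<And>p. p \<in> Hgrp r \<Longrightarrow> psi p = spin_class r (p, mat 1) (w p)"
    and w: "smooth_on (Hgrp r) w"
  shows "nabla r psi q XX =
    spin_class r (q, mat 1) (dH r w q XX + (1/2) *\<^sub>R (matrix_inv q ** XX) *v w q)"
  unfolding nabla_def
proof (rule the_equality)
  let ?s = "\<lambda>p. (p, mat 1) :: cmat \<times> cmat"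
  have s: "(?s has_derivative (\<lambda>x. (x, 0))) (at q within Hgrp r)"
    by (intro has_derivative_Pair has_derivative_ident has_derivative_const)
  have "local_rep r psi UNIV ?s w" by (rule local_rep_global_section[OF psi w])
  moreover have "spin_conn (?s q) (dH r ?s q XX) = (1/2) *\<^sub>R (matrix_inv q ** XX)"
    by (simp add: dH_eq[OF r q XX s] spin_conn_def omegaL_def omegaR_def
        linear_0[OF bounded_linear.linear[OF bounded_linear_cadj]])
  ultimately show "\<exists>U s v. q \<in> U \<and> local_rep r psi U s v \<and>
      spin_class r (q, mat 1) (dH r w q XX + (1/2) *\<^sub>R (matrix_inv q ** XX) *v w q) =
      spin_class r (s q) (dH r v q XX + spin_conn (s q) (dH r s q XX) *v v q)"
    by (intro exI[of _ UNIV] exI[of _ ?s] exI[of _ w]) simp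
next
  fix t assume "\<exists>U s v. q \<in> U \<and> local_rep r psi U s v \<and>
      t = spin_class r (s q) (dH r v q XX + spin_conn (s q) (dH r s q XX) *v v q)"
  then obtain U s v where qU: "q \<in> U" and U: "open U" and s: "smooth_on (U \<inter> Hgrp r) s"
    and v: "smooth_on (U \<inter> Hgrp r) v" and sP: "\<And>p. p \<in> U \<inter> Hgrp r \<Longrightarrow> s p \<in> Pspin r \<and> Pproj (s p) = p"
    and psi': "\<And>p. p \<in> U \<inter> Hgrp r \<Longrightarrow> psi p = spin_class r (s p) (v p)"
    and t: "t = spin_class r (s q) (dH r v q XX + spin_conn (s q) (dH r s q XX) *v v q)"
    unfolding local_rep_def local_section_def by auto
  have ab: "fst (s p) \<in> Hgrp r" "snd (s p) \<in> Hgrp r" "fst (s p) ** cadj (snd (s p)) = p"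
    if "p \<in> U \<inter> Hgrp r" for p
    using sP[OF that] by (auto simp: Pspin_def Pproj_def mem_Times_iff)
  have vw: "v p = cadj (snd (s p)) *v w p" if p: "p \<in> U \<inter> Hgrp r" for p
  proof -
    have "spin_class r (s p) (cadj (snd (s p)) *v w p) = psi p"
      using spin_class_global_gauge[OF ab(1,2)[OF p], of "w p"] p by (simp add: ab(3)[OF p] psi)
    then show ?thesis using ab(1)[OF p] by (simp add: psi'[OF p] spin_class_inject)
  qed
  define ds dw a b da db where "ds = frechet_derivative s (at q within Hgrp r)"
    and "dw = frechet_derivative w (at q within Hgrp r)"
    and "a = fst (s q)" and "b = snd (s q)" and "da = fst (ds XX)" and "db = snd (ds XX)"
  have ds: "(s has_derivative ds) (at q within Hgrp r)"
    unfolding ds_def by (rule smooth_on_Int_open_has_derivative[OF s U qU q])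
  have dw: "(w has_derivative dw) (at q within Hgrp r)"
    unfolding dw_def by (rule smooth_on_Int_open_has_derivative[of UNIV]) (use w q in auto)
  have abq: "a \<in> Hgrp r" "b \<in> Hgrp r" "a ** cadj b = q"
    using ab[of q] q qU by (auto simp: a_def b_def)
  have B: "cadj b \<in> Hgrp r" by (rule cadj_in_Hgrp[OF abq(2)])
  have "((\<lambda>p. fst (s p) ** cadj (snd (s p))) has_derivative
      (\<lambda>x. a ** cadj (snd (ds x)) + fst (ds x) ** cadj b)) (at q within Hgrp r)"
    unfolding a_def b_def
    by (intro mm.FDERIV bounded_linear.has_derivative[OF bounded_linear_cadj] has_derivative_fst
        has_derivative_snd ds)
  then have "((\<lambda>p. p) has_derivative
      (\<lambda>x. a ** cadj (snd (ds x)) + fst (ds x) ** cadj b)) (at q within Hgrp r)"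
    by (rule has_derivative_transform_Int_open[OF _ U qU q]) (rule ab(3))
  from derivative_within_Hgrp_unique[OF r q XX has_derivative_ident this]
  have XX_eq: "XX = a ** cadj db + da ** cadj b" by (simp add: da_def db_def)
  have "((\<lambda>p. cadj (snd (s p)) *v w p) has_derivative
      (\<lambda>x. cadj b *v dw x + cadj (snd (ds x)) *v w q)) (at q within Hgrp r)"
    unfolding b_def
    by (intro mv.FDERIV bounded_linear.has_derivative[OF bounded_linear_cadj] has_derivative_snd ds dw)
  then have "(v has_derivative (\<lambda>x. cadj b *v dw x + cadj (snd (ds x)) *v w q)) (at q within Hgrp r)"
    by (rule has_derivative_transform_Int_open[OF _ U qU q]) (simp add: vw)
  from dH_eq[OF r q XX this] have dv: "dH r v q XX = cadj b *v dw XX + cadj db *v w q"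
    by (simp add: db_def)
  have conn: "spin_conn (s q) (dH r s q XX) =
      (1/2) *\<^sub>R (matrix_inv a ** da - cadj db ** matrix_inv (cadj b))"
    using dH_eq[OF r q XX ds] matrix_inv_cadj[OF abq(2)]
    by (simp add: spin_conn_def omegaL_def omegaR_def cadj_mult a_def b_def da_def db_def)
  have vq: "v q = cadj b *v w q" using vw[of q] q qU by (simp add: b_def)
  have "da ** cadj b = XX - a ** cadj db" by (simp add: XX_eq)
  then have "matrix_inv a ** da ** cadj b = matrix_inv a ** XX - cadj db"
    by (simp add: mm.diff_right Hgrp_inv_cancel[OF abq(1)] flip: matrix_mul_assoc)
  \<comment> \<open>Each Maurer-Cartan form contributes one copy of \<open>cadj db\<close>; half of
    their sum cancels the term \<open>cadj db *v w q\<close> of \<open>dv\<close>.\<close>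
  then have "spin_conn (s q) (dH r s q XX) ** cadj b = (1/2) *\<^sub>R (matrix_inv a ** XX - (cadj db + cadj db))"
    unfolding conn by (simp add: mm.scaleR_left mm.diff_left Hgrp_inv_cancel[OF B])
  also have "\<dots> = (1/2) *\<^sub>R (matrix_inv a ** XX) - cadj db"
    by (simp only: scaleR_diff_right scaleR_half_double)
  finally have "spin_conn (s q) (dH r s q XX) *v v q = (1/2) *\<^sub>R ((matrix_inv a ** XX) *v w q) - cadj db *v w q"
    by (simp add: vq matrix_vector_mul_assoc mv.diff_left mv.scaleR_left)
  also have "matrix_inv a = cadj b ** matrix_inv q"
    by (simp add: matrix_inv_mult[OF abq(1) B] matrix_mul_assoc Hgrp_inv[OF B] flip: abq(3))
  finally have "dH r v q XX + spin_conn (s q) (dH r s q XX) *v v q =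
      cadj b *v (dw XX + (1/2) *\<^sub>R (matrix_inv q ** XX) *v w q)"
    by (simp add: dv mv.add_right mv.scaleR_left mv.scaleR_right matrix_vector_mul_assoc matrix_mul_assoc)
  moreover have "dH r w q XX = dw XX" by (rule dH_eq[OF r q XX dw])
  moreover have "s q = (a, b)" by (simp add: a_def b_def)
  ultimately show "t = spin_class r (q, mat 1) (dH r w q XX + (1/2) *\<^sub>R (matrix_inv q ** XX) *v w q)"
    using spin_class_global_gauge[OF abq(1,2)] by (simp add: t abq(3))
qed

lemma smooth_on_matrix_inv: "smooth_on (Hgrp r) matrix_inv"
proof (rule smooth_on_cong)
  show "smooth_on (Hgrp r) (\<lambda>h. gamma0_pow r ** cadj h ** gamma0_pow r)"
    by (intro mm.smooth_on smooth_on_const bounded_linear.smooth_on[OF bounded_linear_cadj] smooth_on_ident)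
qed (simp add: Hgrp_matrix_inv_eq)

subsection \<open>Tensor fields\<close>

lemma vector_fieldI:
  assumes r: "r \<in> {0, 1}"
    and "\<And>q. q \<in> Hgrp r \<Longrightarrow> XX q = tvec r (q, mat 1) (X q)" "smooth_on (Hgrp r) XX"
  shows "vector_field r XX"
  using assms by (auto simp: vector_field_def tangent_eq_range_tvec[OF r])

lemma vector_field_left_invariant:
  assumes "A \<in> liealg r" shows "vector_field r (\<lambda>q. q ** A)"
  using assms by (auto simp: vector_field_def tangent_def intro!: mm.smooth_on smooth_on_ident smooth_on_const)

text \<open>The constant is -2 divided by 4, since translating a tangent vector back to the identity
  gives \<open>2 *\<^sub>R lg r X\<close>.\<close>

lemma metric_g_trace:
  assumes r: "r \<in> {0, 1}" and q: "q \<in> Hgrp r" and "XX \<in> tangent r q" "YY \<in> tangent r q"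
  shows "metric_g r q XX YY =
    (- ((-1)^r) / 2) * Re (trace ((matrix_inv q ** XX) ** (matrix_inv q ** YY)))"
proof -
  obtain X Z where "XX = tvec r (q, mat 1) X" "YY = tvec r (q, mat 1) Z"
    using assms by (auto simp: tangent_eq_range_tvec[OF r q])
  then show ?thesis
    by (simp add: metric_g_tvec[OF r q] inv_mult_tvec[OF r q] mprod_trace[OF r] mm.scaleR_left mm.scaleR_right
        linear_scale[OF bounded_linear.linear[OF bounded_linear_trace]])
qed

lemma smooth_on_metric_g:
  assumes r: "r \<in> {0, 1}" and XX: "vector_field r XX" and YY: "vector_field r YY"
  shows "smooth_on (Hgrp r) (\<lambda>q. metric_g r q (XX q) (YY q))"
proof (rule smooth_on_cong)
  show "smooth_on (Hgrp r) (\<lambda>q. (- ((-1)^r) / 2) * Re (trace ((matrix_inv q ** XX q) ** (matrix_inv q ** YY q))))"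
    using XX YY unfolding vector_field_def
    by (intro bounded_bilinear.smooth_on[OF bounded_bilinear_mult] bounded_linear.smooth_on[OF bounded_linear_Re]
        bounded_linear.smooth_on[OF bounded_linear_trace] mm.smooth_on smooth_on_const smooth_on_matrix_inv) auto
qed (use XX YY in \<open>simp add: metric_g_trace[OF r] vector_field_def\<close>)

text \<open>In components A is X \<mapsto> aX + b<V,X>V, symmetric because <V,X><V,Z> is. Only
  values on tangent vectors are prescribed, as \<open>A\<close> is arbitrary elsewhere.\<close>

lemma tensor_field11_rank_one_perturbation:
  assumes r: "r \<in> {0, 1}" and xi: "vector_field r xi"
    and A: "\<And>q XX. q \<in> Hgrp r \<Longrightarrow> XX \<in> tangent r q \<Longrightarrow>
      A q XX = a *\<^sub>R XX + (b * metric_g r q (xi q) XX) *\<^sub>R xi q"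
  shows "tensor_field11 r A" "symmetric_tensor r A"
proof -
  let ?t = "\<lambda>q. tvec r (q, mat 1)"
  obtain V where V: "\<And>q. q \<in> Hgrp r \<Longrightarrow> xi q = ?t q (V q)"
  proof -
    have "\<forall>q\<in>Hgrp r. \<exists>Z. xi q = ?t q Z"
      using xi by (auto simp: vector_field_def tangent_eq_range_tvec[OF r])
    then show ?thesis using that by metis
  qed
  have At: "A q (?t q X) = ?t q (a *\<^sub>R X + (b * mprod r (V q) X) *\<^sub>R V q)" if q: "q \<in> Hgrp r" for q X
  proof -
    interpret bounded_linear "?t q" by (rule bounded_linear_tvec[OF r q])
    show ?thesis
      using A[OF q] by (simp add: tangent_eq_range_tvec[OF r q] V[OF q] metric_g_tvec[OF r q] add scaleR)
  qed
  have bil: "mprod r X (a *\<^sub>R Z + b *\<^sub>R W) = a * mprod r X Z + b * mprod r X W"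
    "mprod r (a *\<^sub>R Z + b *\<^sub>R W) X = a * mprod r Z X + b * mprod r W X" for X Z W a b
    by (simp_all add: mprod_def algebra_simps)
  have comm: "mprod r X Z = mprod r Z X" for X Z by (simp add: mprod_def mult.commute)
  show "symmetric_tensor r A"
    unfolding symmetric_tensor_def
    by (auto simp: tangent_eq_range_tvec[OF r] At metric_g_tvec[OF r] bil) (simp add: comm)
  have "smooth_on (Hgrp r) (\<lambda>q. A q (XX q))" if XX: "vector_field r XX" for XX
  proof (rule smooth_on_cong)
    show "smooth_on (Hgrp r) (\<lambda>q. a *\<^sub>R XX q + (b * metric_g r q (xi q) (XX q)) *\<^sub>R xi q)"
      using xi XX unfolding vector_field_def
      by (intro smooth_on_add bounded_bilinear.smooth_on[OF bounded_bilinear_scaleR]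
          bounded_bilinear.smooth_on[OF bounded_bilinear_mult] smooth_on_const
          smooth_on_metric_g[OF r xi XX]) auto
  qed (use XX in \<open>simp add: A vector_field_def\<close>)
  moreover have "A q (c *\<^sub>R XX + d *\<^sub>R YY) = c *\<^sub>R A q XX + d *\<^sub>R A q YY"
    if q: "q \<in> Hgrp r" and t: "XX \<in> tangent r q" "YY \<in> tangent r q" for q XX YY c d
  proof -
    interpret t: bounded_linear "?t q" by (rule bounded_linear_tvec[OF r q])
    obtain X Z where XZ: "XX = ?t q X" "YY = ?t q Z"
      using t by (auto simp: tangent_eq_range_tvec[OF r q])
    have "a *\<^sub>R (c *\<^sub>R X + d *\<^sub>R Z) + (b * mprod r (V q) (c *\<^sub>R X + d *\<^sub>R Z)) *\<^sub>R V q
       = c *\<^sub>R (a *\<^sub>R X + (b * mprod r (V q) X) *\<^sub>R V q) + d *\<^sub>R (a *\<^sub>R Z + (b * mprod r (V q) Z) *\<^sub>R V q)"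
      by (simp add: bil algebra_simps)
    then show ?thesis
      by (simp add: XZ At[OF q] flip: t.add t.scaleR)
  qed
  ultimately show "tensor_field11 r A"
    unfolding tensor_field11_def by (auto simp: At tangent_eq_range_tvec[OF r])
qed

text \<open>For \<open>r = 1\<close> the kernel of \<open>gam r D\<close> is nontrivial when \<open>D\<close> is null, but then it consists of null spinors.\<close>

lemma gam_mult_eq_0D:
  assumes r: "r \<in> {0, 1}" and 0: "gam r D *v w = 0"
    and w: "(\<Sum>i\<in>UNIV. cnj (w $ i) * (gamma0_pow r *v w) $ i) \<noteq> 0"
  shows "D = 0"
proof -
  have "w \<noteq> 0" using w by (auto simp: sum_2)
  \<comment> \<open>Applying \<open>gam r D\<close> twice shows that a nonzero kernel vector makes D
    null, which settles the definite case r = 0.\<close>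
  have "gam r D *v (gam r D *v w) = (- mprod r D D) *\<^sub>R w"
    by (simp add: matrix_vector_mul_assoc gam_square[OF r] mv.scaleR_left mv.minus_left)
  then have null: "mprod r D D = 0" using \<open>w \<noteq> 0\<close> by (simp add: 0)
  have "D $ 0 = 0 \<and> D $ 1 = 0 \<and> D $ 2 = 0"
  proof (cases "r = 0")
    case True
    then show ?thesis using null
      by (simp add: mprod_def) (smt (verit) zero_le_square mult_eq_0_iff)
  next
    case False
    then have [simp]: "r = 1" using r by simp
    let ?d = "D$0" and ?z = "Complex (D$1) (D$2)"
    have "(cmod ?z)^2 = ?d^2"
      unfolding cmod_power2 using null by (simp add: mprod_def power2_eq_square)
    from arg_cong[OF this, of sqrt] have z: "cmod ?z = \<bar>?d\<bar>" by simp
    \<comment> \<open>The first row of the kernel equation. As |z| = |d|, a nonzero d would force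
      both components of w to have equal modulus, hence a null spinor.\<close>
    have dz: "of_real ?d * w$1 = - ?z * w$2"
      using arg_cong[OF 0, of "\<lambda>v. v$1"]
      by (simp add: gam_def gamma0_def gamma1_def gamma2_def matrix_vector_mult_def sum_2 complex_eq_iff algebra_simps)
    have "\<bar>?d\<bar> * cmod (w$1) = \<bar>?d\<bar> * cmod (w$2)"
      using arg_cong[OF dz, of cmod] by (simp add: norm_mult z)
    moreover have "cmod (w$1) \<noteq> cmod (w$2)"
    proof
      assume "cmod (w$1) = cmod (w$2)"
      moreover have "cnj x * x = of_real ((cmod x)^2)" for x
        by (simp only: complex_norm_square mult.commute)
      ultimately have "cnj (w$1) * w$1 = cnj (w$2) * w$2" by simp
      then show False using w
        by (simp add: sum_2 gamma0_pow_def gamma0_def matrix_vector_mult_def)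
    qed
    ultimately have "?d = 0" by simp
    then show ?thesis using z by (simp add: complex_eq_iff)
  qed
  then show ?thesis by (simp add: vec_eq_iff forall_3 three_index)
qed

subsection \<open>A criterion for generalized Killing spinors\<close>

lemma gam_form_scale:
  assumes "r \<in> {0, 1}"
  shows "(\<Sum>i\<in>UNIV. cnj ((gam r Y *v v) $ i) * (gamma0_pow r *v (gam r Y *v w)) $ i)
       = of_real ((-1)^r * mprod r Y Y) * (\<Sum>i\<in>UNIV. cnj (v $ i) * (gamma0_pow r *v w) $ i)"
  unfolding hermitian_form_mult gam_form[OF assms] mv.scaleR_left
  by (simp only: vector_scaleR_component scaleR_conv_of_real[where 'a = complex] sum_2)
    (simp add: algebra_simps)

lemma one_vec_form:
  assumes "r \<in> {0, 1}" "e \<in> signs r"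
  shows "(\<Sum>i\<in>UNIV. cnj (one_vec e $ i) * (gamma0_pow r *v one_vec e) $ i) = of_real e"
  using assms
  by (auto simp: signs_def one_vec_def gamma0_pow_def gamma0_def sum_2 matrix_vector_mult_def mat_def
      split: if_splits)

text \<open>Conjugation by \<open>gam r Z\<close> is the half-turn about Z: it fixes Z and negates
  its orthogonal complement.\<close>

lemma gam_mult_lg:
  assumes r: "r \<in> {0, 1}" and Z: "mprod r Z Z \<in> {1, -1}"
  shows "gam r Z ** lg r X = lg r ((2 * mprod r Z Z * mprod r Z X) *\<^sub>R Z - X) ** gam r Z"
proof -
  interpret lg: bounded_linear "lg r" by (rule bounded_linear_lg[OF r])
  let ?G = "gam r Z" and ?n = "mprod r Z Z"
  have n: "?n * ?n = 1" using Z by auto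
  have comm: "mprod r U V = mprod r V U" for U V by (simp add: mprod_def mult.commute)
  \<comment> \<open>A further factor G on the right removes one G up to -n; since n * n = 1,
    multiplying by -n once more divides it out.\<close>
  have "(?G ** lg r X ** ?G) ** ?G = (- ?n) *\<^sub>R (?G ** lg r X)"
    by (simp add: gam_square[OF r] mm.scaleR_right mm.minus_right flip: matrix_mul_assoc)
  then have "(- ?n) *\<^sub>R (- ?n) *\<^sub>R (?G ** lg r X)
      = (- ?n) *\<^sub>R (lg r (?n *\<^sub>R X - (2 * mprod r X Z) *\<^sub>R Z) ** ?G)"
    by (simp add: gam_lg_gam[OF r])
  also have "\<dots> = lg r ((- ?n) *\<^sub>R (?n *\<^sub>R X - (2 * mprod r X Z) *\<^sub>R Z)) ** ?G"
    by (simp only: lg.scaleR mm.scaleR_left)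
  also have "(- ?n) *\<^sub>R (?n *\<^sub>R X - (2 * mprod r X Z) *\<^sub>R Z) = (2 * ?n * mprod r Z X) *\<^sub>R Z - X"
    using n by (simp add: comm[of X] scaleR_diff_right mult.assoc)
  finally show ?thesis using n by simp
qed

text \<open>Differentiates the constant map \<open>matrix_inv p ** p\<close> on
  \<open>Hgrp r\<close>; the formula is therefore claimed on tangent vectors only.\<close>

lemma matrix_inv_has_derivative:
  assumes r: "r \<in> {0, 1}" and q: "q \<in> Hgrp r"
  obtains D where "(matrix_inv has_derivative D) (at q within Hgrp r)"
    and "\<And>XX. XX \<in> tangent r q \<Longrightarrow> D XX = - (matrix_inv q ** XX ** matrix_inv q)"
proof -
  have D: "(matrix_inv has_derivative frechet_derivative matrix_inv (at q within Hgrp r)) (at q within Hgrp r)"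
    (is "(_ has_derivative ?D) _")
    by (rule smooth_on_Int_open_has_derivative[of UNIV]) (use smooth_on_matrix_inv q in auto)
  have "((\<lambda>p. matrix_inv p ** p) has_derivative (\<lambda>x. matrix_inv q ** x + ?D x ** q)) (at q within Hgrp r)"
    by (rule mm.FDERIV[OF D has_derivative_ident])
  then have "((\<lambda>p. mat 1) has_derivative (\<lambda>x. matrix_inv q ** x + ?D x ** q)) (at q within Hgrp r)"
    by (rule has_derivative_transform_Int_open[where U = UNIV]) (use q in \<open>auto simp: Hgrp_inv\<close>)
  note d = derivative_within_Hgrp_unique[OF r q _ this has_derivative_const]
  have "?D XX = - (matrix_inv q ** XX ** matrix_inv q)" if "XX \<in> tangent r q" for XX
  proof -
    have "(matrix_inv q ** XX + ?D XX ** q) ** matrix_inv q = 0" by (simp add: d[OF that])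
    then show ?thesis
      by (simp add: mm.add_left Hgrp_inv_cancel[OF q] eq_neg_iff_add_eq_0 add.commute)
  qed
  with D show thesis by (rule that)
qed

text \<open>The two families differ only in \<open>w\<close>, \<open>Z\<close>, \<open>a\<close> and
  \<open>b\<close>. By \<open>deriv\<close>, each reduces to one computation in the global gauge;
  the equivalence gives existence and uniqueness of the tensor on tangent vectors.\<close>

lemma generalized_killing_criterion:
  assumes r: "r \<in> {0, 1}" and e: "e \<noteq> 0"
    and psi: "\<And>p. p \<in> Hgrp r \<Longrightarrow> psi p = spin_class r (p, mat 1) (w p)"
    and w: "smooth_on (Hgrp r) w"
    and unit: "\<And>p. p \<in> Hgrp r \<Longrightarrow> (\<Sum>i\<in>UNIV. cnj (w p $ i) * (gamma0_pow r *v w p) $ i) = of_real e"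
    and xi: "\<And>p. p \<in> Hgrp r \<Longrightarrow> xi p = tvec r (p, mat 1) (Z p)" "smooth_on (Hgrp r) xi"
    and deriv: "\<And>q X. q \<in> Hgrp r \<Longrightarrow> dH r w q (tvec r (q, mat 1) X) + lg r X *v w q
      = 2 *\<^sub>R (lg r (a *\<^sub>R X + (b * mprod r (Z q) X) *\<^sub>R Z q) *v w q)"
  shows "unit_generalized_killing r e psi"
    and "associated_tensor r psi A \<longleftrightarrow> (\<forall>q\<in>Hgrp r. \<forall>XX\<in>tangent r q.
      A q XX = a *\<^sub>R XX + (b * metric_g r q (xi q) XX) *\<^sub>R xi q)" (is "_ \<longleftrightarrow> ?formula A")
proof -
  let ?t = "\<lambda>q. tvec r (q, mat 1)" and ?V = "\<lambda>q X. a *\<^sub>R X + (b * mprod r (Z q) X) *\<^sub>R Z q"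
  have vf: "vector_field r xi" by (rule vector_fieldI[OF r xi])
  have nabla_iff: "nabla r psi q (?t q X) = scale_spinor (\<i>^r) (clifford r (?t q X') (psi q)) \<longleftrightarrow> X' = ?V q X"
    if q: "q \<in> Hgrp r" for q X X'
  proof -
    interpret lg: bounded_linear "lg r" by (rule bounded_linear_lg[OF r])
    have "?t q X \<in> tangent r q" by (simp add: tangent_eq_range_tvec[OF r q])
    from nabla_global_gauge[OF r q this psi w]
    have "nabla r psi q (?t q X) = spin_class r (q, mat 1) (2 *\<^sub>R (lg r (?V q X) *v w q))"
      by (simp add: inv_mult_tvec[OF r q] deriv[OF q])
    moreover have "scale_spinor (\<i>^r) (clifford r (?t q X') (psi q))
        = spin_class r (q, mat 1) (2 *\<^sub>R (lg r X' *v w q))"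
    proof -
      have "c *s v = mat c *v v" for c and v :: cvec
        by (simp add: vec_eq_iff forall_2 sum_2 mat_def matrix_vector_mult_def)
      then show ?thesis
        by (simp add: psi[OF q] clifford_global_gauge[OF r q] scale_spinor_class matrix_vector_mul_assoc
            i_gam[OF r] mv.scaleR_left)
    qed
    moreover have "lg r (?V q X) *v w q = lg r X' *v w q \<longleftrightarrow> X' = ?V q X"
    proof
      assume eq: "lg r (?V q X) *v w q = lg r X' *v w q"
      have "gam r (?V q X - X') *v w q = mat (2 / \<i>^r) *v (lg r (?V q X - X') *v w q)"
        by (simp add: gam_eq_lg[OF r] matrix_vector_mul_assoc)
      also have "\<dots> = 0" by (simp add: lg.diff mv.diff_left eq)
      finally have "?V q X - X' = 0"
        by (rule gam_mult_eq_0D[OF r]) (use unit[OF q] e in simp)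
      then show "X' = ?V q X" by simp
    qed simp
    ultimately show ?thesis using q by (simp add: spin_class_inject)
  qed
  have assoc: "associated_tensor r psi A" if A: "?formula A" for A
    unfolding associated_tensor_def
  proof (intro conjI allI impI ballI)
    show "tensor_field11 r A"
      by (rule tensor_field11_rank_one_perturbation(1)[OF r vf, of A a b]) (use A in auto)
    fix XX q assume XX: "vector_field r XX" and q: "q \<in> Hgrp r"
    interpret t: bounded_linear "?t q" by (rule bounded_linear_tvec[OF r q])
    have XXq: "XX q \<in> tangent r q" using XX q by (simp add: vector_field_def)
    then obtain X where X: "XX q = ?t q X" by (auto simp: tangent_eq_range_tvec[OF r q])
    from A q XXq have "A q (XX q) = ?t q (?V q X)"
      by (simp add: X xi(1)[OF q] metric_g_tvec[OF r q] t.add t.scaleR)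
    then show "nabla r psi q (XX q) = scale_spinor (\<i>^r) (clifford r (A q (XX q)) (psi q))"
      by (simp add: X nabla_iff[OF q])
  qed
  moreover have "?formula A" if A: "associated_tensor r psi A"
  proof (intro ballI)
    fix q XX assume q: "q \<in> Hgrp r" and XX: "XX \<in> tangent r q"
    interpret t: bounded_linear "?t q" by (rule bounded_linear_tvec[OF r q])
    obtain X where X: "XX = ?t q X" using XX by (auto simp: tangent_eq_range_tvec[OF r q])
    have "A q XX \<in> tangent r q" using A q XX by (auto simp: associated_tensor_def tensor_field11_def)
    then obtain X' where X': "A q XX = ?t q X'" by (auto simp: tangent_eq_range_tvec[OF r q])
    \<comment> \<open>The Killing equation is assumed for vector fields, so the single tangent
      vector is extended to a left-invariant field.\<close>
    obtain B where B: "B \<in> liealg r" "XX = q ** B" using XX by (auto simp: tangent_def)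
    have "nabla r psi q (q ** B) = scale_spinor (\<i>^r) (clifford r (A q (q ** B)) (psi q))"
      using A q vector_field_left_invariant[OF B(1)] unfolding associated_tensor_def by blast
    then have "X' = ?V q X" using nabla_iff[OF q, of X X'] by (simp add: X'[symmetric] flip: X B(2))
    then show "A q XX = a *\<^sub>R XX + (b * metric_g r q (xi q) XX) *\<^sub>R xi q"
      unfolding X' by (simp add: X xi(1)[OF q] metric_g_tvec[OF r q] t.add t.scaleR)
  qed
  ultimately show "associated_tensor r psi A \<longleftrightarrow> ?formula A" by blast
  let ?A0 = "\<lambda>q XX. a *\<^sub>R XX + (b * metric_g r q (xi q) XX) *\<^sub>R xi q"
  have "associated_tensor r psi ?A0" by (rule assoc) simp
  moreover have "symmetric_tensor r ?A0"
    by (rule tensor_field11_rank_one_perturbation(2)[OF r vf]) simp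
  moreover have "unit_spinor r e psi"
    unfolding unit_spinor_def spinor_field_def
  proof (intro conjI ballI)
    fix q assume q: "q \<in> Hgrp r"
    show "\<exists>U s v. q \<in> U \<and> local_rep r psi U s v"
      using local_rep_global_section[OF psi w] by blast
    show "spin_prod r (psi q) (psi q) = of_real e"
      using q by (simp add: psi spin_prod_class unit)
  qed
  ultimately show "unit_generalized_killing r e psi"
    unfolding unit_generalized_killing_def by blast
qed

subsection \<open>The spinors \<open>psi_R\<close> and \<open>psi_L\<close>\<close>

lemma psi_R_global_gauge:
  assumes r: "r \<in> {0, 1}" and q: "q \<in> Hgrp r"
  shows "psi_R r Y e q = spin_class r (q, mat 1) ((matrix_inv q ** gam r Y ** q) *v one_vec (eps_Y r Y e))"
  by (simp add: psi_R_def xi_R_def psiK_plus_def clifford_global_gauge[OF r q]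
      lg_lam[OF r inv_in_Hgrp[OF q]] matrix_inv_matrix_inv[OF q])

lemma psi_L_global_gauge:
  assumes r: "r \<in> {0, 1}" and q: "q \<in> Hgrp r"
  shows "psi_L r Y e q = spin_class r (q, mat 1) ((gam r Y ** matrix_inv q) *v one_vec (eps_Y r Y e))"
  by (simp add: psi_L_def xi_L_def psiK_minus_def clifford_global_gauge[OF r q] matrix_vector_mul_assoc)

text \<open>The conjugation inside \<open>xi_R\<close> turns left translation into right
  translation, leaving a field linear in q.\<close>

lemma smooth_on_xi_R:
  assumes r: "r \<in> {0, 1}" shows "smooth_on (Hgrp r) (xi_R r Y)"
proof (rule smooth_on_cong)
  show "smooth_on (Hgrp r) (\<lambda>q. 2 *\<^sub>R (lg r Y ** q))"
    by (intro bounded_bilinear.smooth_on[OF bounded_bilinear_scaleR] mm.smooth_on smooth_on_const smooth_on_ident)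
  show "2 *\<^sub>R (lg r Y ** q) = xi_R r Y q" if q: "q \<in> Hgrp r" for q
    by (simp add: xi_R_def tvec_global_section[OF r q] lg_lam[OF r inv_in_Hgrp[OF q]] matrix_inv_matrix_inv[OF q]
        matrix_mul_assoc Hgrp_inv[OF q])
qed

lemma smooth_on_xi_L:
  assumes r: "r \<in> {0, 1}" shows "smooth_on (Hgrp r) (xi_L r Y)"
proof (rule smooth_on_cong)
  show "smooth_on (Hgrp r) (\<lambda>q. 2 *\<^sub>R (q ** lg r Y))"
    by (intro bounded_bilinear.smooth_on[OF bounded_bilinear_scaleR] mm.smooth_on smooth_on_const smooth_on_ident)
  show "2 *\<^sub>R (q ** lg r Y) = xi_L r Y q" if q: "q \<in> Hgrp r" for q
    by (simp add: xi_L_def tvec_global_section[OF r q])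
qed

lemma eps_Y_in_signs:
  assumes "r \<in> {0, 1}" "mprod r Y Y \<in> {1, -1}" "e \<in> signs r"
  shows "eps_Y r Y e \<in> signs r"
proof (cases "r = 0")
  \<comment> \<open>For r = 0 the form is positive definite, so the value -1 is impossible.\<close>
  case True
  then have "mprod r Y Y \<ge> 0" by (simp add: mprod_def)
  then have "mprod r Y Y = 1" using assms(2) by auto
  then show ?thesis using assms True by (simp add: eps_Y_def signs_def)
next
  case False
  then show ?thesis using assms by (auto simp: eps_Y_def signs_def)
qed

lemma gam_one_vec_form:
  assumes r: "r \<in> {0, 1}" and Y: "mprod r Y Y \<in> {1, -1}" and e: "e \<in> signs r"
  shows "of_real ((-1)^r * mprod r Y Y) *
    (\<Sum>i\<in>UNIV. cnj (one_vec (eps_Y r Y e) $ i) * (gamma0_pow r *v one_vec (eps_Y r Y e)) $ i) = of_real e"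
proof -
  have "((-1)^r * mprod r Y Y) * eps_Y r Y e = e"
    using r Y by (auto simp: eps_Y_def)
  then show ?thesis
    unfolding one_vec_form[OF r eps_Y_in_signs[OF assms]] by (metis of_real_mult)
qed

lemma psi_R_generalized_killing:
  assumes r: "r \<in> {0, 1}" and Y: "mprod r Y Y \<in> {1, -1}" and e: "e \<in> signs r"
  shows "unit_generalized_killing r e (psi_R r Y e)"
    and "associated_tensor r (psi_R r Y e) A \<longleftrightarrow> (\<forall>q\<in>Hgrp r. \<forall>XX\<in>tangent r q. A q XX =
      (-3/2) *\<^sub>R XX + (2 * mprod r Y Y * metric_g r q (xi_R r Y q) XX) *\<^sub>R xi_R r Y q)"
proof -
  interpret lg: bounded_linear "lg r" by (rule bounded_linear_lg[OF r])
  define v where "v = one_vec (eps_Y r Y e)"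
  define w where "w = (\<lambda>q. (matrix_inv q ** gam r Y ** q) *v v)"
  define Z where "Z = (\<lambda>q. lam r (matrix_inv q) Y)"
  have e0: "e \<noteq> 0" using e by (auto simp: signs_def split: if_splits)
  have psi: "psi_R r Y e q = spin_class r (q, mat 1) (w q)" if "q \<in> Hgrp r" for q
    by (simp add: psi_R_global_gauge[OF r that] w_def v_def)
  have w: "smooth_on (Hgrp r) w"
    unfolding w_def by (intro mv.smooth_on mm.smooth_on smooth_on_const smooth_on_ident smooth_on_matrix_inv)
  have unit: "(\<Sum>i\<in>UNIV. cnj (w q $ i) * (gamma0_pow r *v w q) $ i) = of_real e" if q: "q \<in> Hgrp r" for q
  proof -
    \<comment> \<open>Regrouped so that the two group factors preserve the form and only
      \<open>gam r Y\<close> scales it.\<close>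
    have "w q = matrix_inv q *v (gam r Y *v (q *v v))"
      by (simp add: w_def matrix_vector_mul_assoc matrix_mul_assoc)
    then show ?thesis
      using gam_one_vec_form[OF assms]
      by (simp only: Hgrp_form_invariant[OF inv_in_Hgrp[OF q]] gam_form_scale[OF r] Hgrp_form_invariant[OF q] v_def)
  qed
  have xi: "xi_R r Y q = tvec r (q, mat 1) (Z q)" for q
    by (simp add: xi_R_def Z_def)
  have deriv: "dH r w q (tvec r (q, mat 1) X) + lg r X *v w q
      = 2 *\<^sub>R (lg r ((-3/2) *\<^sub>R X + (2 * mprod r Y Y * mprod r (Z q) X) *\<^sub>R Z q) *v w q)"
    if q: "q \<in> Hgrp r" for q X
  proof -
    obtain D where D: "(matrix_inv has_derivative D) (at q within Hgrp r)"
      "\<And>XX. XX \<in> tangent r q \<Longrightarrow> D XX = - (matrix_inv q ** XX ** matrix_inv q)"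
      by (rule matrix_inv_has_derivative[OF r q]) blast
    have t: "tvec r (q, mat 1) X \<in> tangent r q" by (simp add: tangent_eq_range_tvec[OF r q])
    have "(w has_derivative (\<lambda>x. ((matrix_inv q ** gam r Y) ** x + (matrix_inv q ** 0 + D x ** gam r Y) ** q) *v v))
        (at q within Hgrp r)"
      unfolding w_def
      by (intro mv.bounded_linear_left[THEN bounded_linear.has_derivative] mm.FDERIV D(1) has_derivative_ident has_derivative_const)
    from dH_eq[OF r q t this] D(2)[OF t]
    have "dH r w q (tvec r (q, mat 1) X) = (2 *\<^sub>R (matrix_inv q ** gam r Y ** q ** lg r X)
        - 2 *\<^sub>R (lg r X ** (matrix_inv q ** gam r Y ** q))) *v v"
      by (simp add: inv_mult_tvec[OF r q] tvec_global_section[OF r q] mm.scaleR_left mm.scaleR_right mm.minus_left matrix_mul_assoc Hgrp_inv[OF q])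
    also have G: "matrix_inv q ** gam r Y ** q = gam r (Z q)"
      by (simp add: Z_def lg_lam[OF r inv_in_Hgrp[OF q]] matrix_inv_matrix_inv[OF q])
    also have "gam r (Z q) ** lg r X = lg r ((2 * mprod r Y Y * mprod r (Z q) X) *\<^sub>R Z q - X) ** gam r (Z q)"
      using gam_mult_lg[OF r, of "Z q" X] Y by (simp add: Z_def mprod_lam[OF r inv_in_Hgrp[OF q]])
    finally have "dH r w q (tvec r (q, mat 1) X) + lg r X *v w q =
        (2 *\<^sub>R lg r ((2 * mprod r Y Y * mprod r (Z q) X) *\<^sub>R Z q - X) - 2 *\<^sub>R lg r X + lg r X) *v w q"
      by (simp add: w_def G mm.diff_left mm.add_left mm.scaleR_left mv.diff_left mv.add_left mv.scaleR_left matrix_vector_mul_assoc)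
    \<comment> \<open>Coefficients of X: -2 from the half-turn, -2 from differentiating the inverse,
      1 from the connection. Half of -3 is -3/2.\<close>
    also have "2 *\<^sub>R lg r ((2 * mprod r Y Y * mprod r (Z q) X) *\<^sub>R Z q - X) - 2 *\<^sub>R lg r X + lg r X
        = lg r (2 *\<^sub>R ((-3/2) *\<^sub>R X + (2 * mprod r Y Y * mprod r (Z q) X) *\<^sub>R Z q))"
      by (simp flip: lg.scaleR lg.diff lg.add) (rule arg_cong[of _ _ "lg r"], simp add: vec_eq_iff algebra_simps)
    finally show ?thesis by (simp only: lg.scaleR mv.scaleR_left)
  qed
  note criterion = generalized_killing_criterion[OF r e0 psi w unit xi smooth_on_xi_R[OF r] deriv]
  show "unit_generalized_killing r e (psi_R r Y e)" by (rule criterion(1))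
  show "associated_tensor r (psi_R r Y e) A \<longleftrightarrow> (\<forall>q\<in>Hgrp r. \<forall>XX\<in>tangent r q. A q XX =
      (-3/2) *\<^sub>R XX + (2 * mprod r Y Y * metric_g r q (xi_R r Y q) XX) *\<^sub>R xi_R r Y q)"
    by (rule criterion(2))
qed

lemma psi_L_generalized_killing:
  assumes r: "r \<in> {0, 1}" and Y: "mprod r Y Y \<in> {1, -1}" and e: "e \<in> signs r"
  shows "unit_generalized_killing r e (psi_L r Y e)"
    and "associated_tensor r (psi_L r Y e) A \<longleftrightarrow> (\<forall>q\<in>Hgrp r. \<forall>XX\<in>tangent r q. A q XX =
      (3/2) *\<^sub>R XX - (2 * mprod r Y Y * metric_g r q (xi_L r Y q) XX) *\<^sub>R xi_L r Y q)"
proof -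
  interpret lg: bounded_linear "lg r" by (rule bounded_linear_lg[OF r])
  define v where "v = one_vec (eps_Y r Y e)"
  define w where "w = (\<lambda>q. (gam r Y ** matrix_inv q) *v v)"
  have e0: "e \<noteq> 0" using e by (auto simp: signs_def split: if_splits)
  have psi: "psi_L r Y e q = spin_class r (q, mat 1) (w q)" if "q \<in> Hgrp r" for q
    by (simp add: psi_L_global_gauge[OF r that] w_def v_def)
  have w: "smooth_on (Hgrp r) w"
    unfolding w_def by (intro mv.smooth_on mm.smooth_on smooth_on_const smooth_on_matrix_inv)
  have unit: "(\<Sum>i\<in>UNIV. cnj (w q $ i) * (gamma0_pow r *v w q) $ i) = of_real e" if q: "q \<in> Hgrp r" for q
  proof -
    have "w q = gam r Y *v (matrix_inv q *v v)"
      by (simp add: w_def matrix_vector_mul_assoc)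
    then show ?thesis
      using gam_one_vec_form[OF assms]
      by (simp only: Hgrp_form_invariant[OF inv_in_Hgrp[OF q]] gam_form_scale[OF r] v_def)
  qed
  have deriv: "dH r w q (tvec r (q, mat 1) X) + lg r X *v w q
      = 2 *\<^sub>R (lg r ((3/2) *\<^sub>R X + (- 2 * mprod r Y Y * mprod r Y X) *\<^sub>R Y) *v w q)"
    if q: "q \<in> Hgrp r" for q X
  proof -
    obtain D where D: "(matrix_inv has_derivative D) (at q within Hgrp r)"
      "\<And>XX. XX \<in> tangent r q \<Longrightarrow> D XX = - (matrix_inv q ** XX ** matrix_inv q)"
      by (rule matrix_inv_has_derivative[OF r q]) blast
    have t: "tvec r (q, mat 1) X \<in> tangent r q" by (simp add: tangent_eq_range_tvec[OF r q])
    have "(w has_derivative (\<lambda>x. (gam r Y ** D x) *v v)) (at q within Hgrp r)"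
      unfolding w_def
      by (intro mv.bounded_linear_left[THEN bounded_linear.has_derivative]
          mm.bounded_linear_right[THEN bounded_linear.has_derivative] D(1))
    from dH_eq[OF r q t this] D(2)[OF t]
    have "dH r w q (tvec r (q, mat 1) X) = (- (2 *\<^sub>R (gam r Y ** lg r X ** matrix_inv q))) *v v"
      by (simp add: inv_mult_tvec[OF r q] mm.scaleR_left mm.scaleR_right mm.minus_right matrix_mul_assoc)
    also have "gam r Y ** lg r X = lg r ((2 * mprod r Y Y * mprod r Y X) *\<^sub>R Y - X) ** gam r Y"
      by (rule gam_mult_lg[OF r Y])
    finally have "dH r w q (tvec r (q, mat 1) X) + lg r X *v w q =
        (lg r X - 2 *\<^sub>R lg r ((2 * mprod r Y Y * mprod r Y X) *\<^sub>R Y - X)) *v w q"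
      by (simp add: w_def mm.diff_left mm.scaleR_left mv.diff_left mv.minus_left mv.scaleR_left matrix_vector_mul_assoc matrix_mul_assoc)
    \<comment> \<open>Only the inverse is differentiated here, so the half-turn enters with factor
      -2 and contributes 2 to the coefficient of X; with 1 from the connection, half of 3 is
      3/2.\<close>
    also have "lg r X - 2 *\<^sub>R lg r ((2 * mprod r Y Y * mprod r Y X) *\<^sub>R Y - X)
        = lg r (2 *\<^sub>R ((3/2) *\<^sub>R X + (- 2 * mprod r Y Y * mprod r Y X) *\<^sub>R Y))"
      by (simp flip: lg.scaleR lg.diff) (rule arg_cong[of _ _ "lg r"], simp add: vec_eq_iff algebra_simps)
    finally show ?thesis by (simp only: lg.scaleR mv.scaleR_left)
  qed
  \<comment> \<open>The components of \<open>xi_L\<close> in the global gauge are constantly Y, so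
    \<open>xi_L_def\<close> itself is the required hypothesis.\<close>
  note criterion = generalized_killing_criterion[OF r e0 psi w unit xi_L_def smooth_on_xi_L[OF r] deriv]
  show "unit_generalized_killing r e (psi_L r Y e)" by (rule criterion(1))
  show "associated_tensor r (psi_L r Y e) A \<longleftrightarrow> (\<forall>q\<in>Hgrp r. \<forall>XX\<in>tangent r q. A q XX =
      (3/2) *\<^sub>R XX - (2 * mprod r Y Y * metric_g r q (xi_L r Y q) XX) *\<^sub>R xi_L r Y q)"
    using criterion(2)[of A] by simp
qed

theorem proposition3p3:
  fixes r :: nat and Y :: "real^3" and \<epsilon> :: real
  assumes "r \<in> {0, 1}" and "mprod r Y Y \<in> {1, -1}" and "\<epsilon> \<in> signs r"
  shows "eps_Y r Y \<epsilon> \<in> signs r \<and>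
    unit_generalized_killing r \<epsilon> (psi_R r Y \<epsilon>) \<and>
    unit_generalized_killing r \<epsilon> (psi_L r Y \<epsilon>) \<and>
    (\<forall>q\<in>Hgrp r. psi_R r Y \<epsilon> q =
       spin_class r (q, mat 1) ((matrix_inv q ** gam r Y ** q) *v one_vec (eps_Y r Y \<epsilon>))) \<and>
    (\<forall>q\<in>Hgrp r. psi_L r Y \<epsilon> q =
       spin_class r (q, mat 1) ((gam r Y ** matrix_inv q) *v one_vec (eps_Y r Y \<epsilon>))) \<and>
    (\<forall>A. associated_tensor r (psi_R r Y \<epsilon>) A \<longleftrightarrow>
       (\<forall>q\<in>Hgrp r. \<forall>XX\<in>tangent r q. A q XX =
          (-3/2) *\<^sub>R XX + (2 * mprod r Y Y * metric_g r q (xi_R r Y q) XX) *\<^sub>R xi_R r Y q)) \<and>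
    (\<forall>A. associated_tensor r (psi_L r Y \<epsilon>) A \<longleftrightarrow>
       (\<forall>q\<in>Hgrp r. \<forall>XX\<in>tangent r q. A q XX =
          (3/2) *\<^sub>R XX - (2 * mprod r Y Y * metric_g r q (xi_L r Y q) XX) *\<^sub>R xi_L r Y q))"
  using eps_Y_in_signs[OF assms] psi_R_generalized_killing[OF assms] psi_L_generalized_killing[OF assms]
    psi_R_global_gauge[OF assms(1)] psi_L_global_gauge[OF assms(1)]
  by (intro conjI allI ballI)

end
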